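(* The following hold: $\Sigma(\mathrm{NMAJ})\equiv_{\mathrm W}\Sigma(\mathrm{NGEQ})\equiv_{\mathrm W}\mathrm{DIS}$; $\Pi(\mathrm{NMAJ})\equiv_{\mathrm{sW}}\mathrm{HYP}$; $\mathrm{DIS}<_{\mathrm W}\mathrm{NMAJ}<_{\mathrm W}\mathrm{HYP}$; and $\mathrm{NON}<_{\mathrm W}\mathrm{HYP}^{\mathcal D}$. In particular, $\mathrm{NMAJ}$ is not stashable, i.e., $\mathrm{NMAJ}\not\equiv_{\mathrm W}\Sigma(\mathrm{NMAJ})$.
   Context: A represented space is a set $X$ with a partial surjective map $\delta_X:\subseteq\mathbb N^{\mathbb N}\to X$. A problem is a partial multi-valued function $f:\subseteq X\rightrightarrows Y$ between represented spaces that has a realizer; a realizer of $f$ is a function $F:\subseteq\mathbb N^{\mathbb N}\to\mathbb N^{\mathbb N}$ with $\delta_YF(p)\in f\delta_X(p)$ for all $p\in\mathrm{dom}(f\delta_X)$. For $p,q\in\mathbb N^{\mathbb N}$, $\langle p,q\rangle(2n)=p(n)$, $\langle p,q\rangle(2n+1)=q(n)$. For problems $f,g$: $f\leq_{\mathrm W}g$ if there are computable $H,K:\subseteq\mathbb N^{\mathbb N}\to\mathbb N^{\mathbb N}$ such that $H\langle\mathrm{id},GK\rangle$ is a realizer of $f$ whenever $G$ is a realizer of $g$; $f\leq_{\mathrm{sW}}g$ is defined likewise with $HGK$ instead of $H\langle\mathrm{id},GK\rangle$. $\equiv_{\mathrm W},\equiv_{\mathrm{sW}}$ are the induced equivalences;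 $f<_{\mathrm W}g$ means $f\leq_{\mathrm W}g$ and $g\not\leq_{\mathrm W}f$. For a represented space $Y$, the completion $\overline Y:=Y\cup\{\bot\}$ ($\bot\notin Y$) is represented by $\delta_{\overline Y}(p)=\delta_Y(p-1)$ if $p-1\in\mathrm{dom}(\delta_Y)$ and $\delta_{\overline Y}(p)=\bot$ otherwise, where $p-1\in\mathbb N^{\mathbb N}\cup\mathbb N^*$ is the concatenation of $p(0)-1,p(1)-1,\dots$ and $0-1$ is the empty word. $\mathbb N^{\mathbb N}$ is represented by the identity, $\mathbb N$ by $p\mapsto p(0)$, and $X^{\mathbb N}$ by $\langle p_0,p_1,\dots\rangle\mapsto(\delta_X(p_n))_n$, where $\langle p_0,p_1,\dots\rangle\langle n,k\rangle:=p_n(k)$ and $\langle n,k\rangle:=\frac12(n+k)(n+k+1)+k$ for $n,k\in\mathbb N$. For $f:\subseteq X\rightrightarrows Y$: $\Pi f:\subseteq X^{\mathbb N}\rightrightarrows Y^{\mathbb N}$ has domain $\mathrm{dom}(f)^{\mathbb N}$ and $\Pi f((x_n)_n)=\{(y_n)_n:(\forall n)\ y_n\in f(x_n)\}$; $\Sigma f:\subseteq X^{\mathbb N}\rightrightarrows\overline Y^{\mathbb N}$ has domain $\mathrm{dom}(f)^{\mathbb N}$ and $\Sigma f((x_n)_n)=\{(y_n)_n\in\overline Y^{\mathbb N}:(\exists n)\ y_n\in f(x_n)\}$. $\mathcal D$ is the set of Turing degrees, represented by $p\mapsto\deg_{\mathrm T}(p)$. For $y\in Y$ and $q\in\mathbb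 N^{\mathbb N}$, $y\leq_{\mathrm T}q$ means that some name of $y$ is Turing reducible to $q$. $f^{\mathcal D}:\subseteq X\rightrightarrows\mathcal D$ has $\mathrm{dom}(f^{\mathcal D})=\mathrm{dom}(f)$ and $f^{\mathcal D}(x)=\{\deg_{\mathrm T}(q):(\exists y\leq_{\mathrm T}q)\ y\in f(x)\}$. $\varphi^p$ is a standard Gödel numbering of the partial functions $\varphi_i^p:\subseteq\mathbb N\to\mathbb N$ computable relative to $p$; for $i\in\mathbb N$, $p\in\mathbb N^{\mathbb N}$, $\langle i,p\rangle:=ip$ (concatenation). The condition $\varphi_i^p(n)\not\geq k$ means that either $\varphi_i^p(n)$ is undefined, or it is defined and $\varphi_i^p(n)<k$. - $\mathrm{NGEQ}:\mathbb N^{\mathbb N}\rightrightarrows\mathbb N$, $\langle\langle i,n\rangle,p\rangle\mapsto\{k:\varphi_i^p(n)\not\geq k\}$. - $\mathrm{NMAJ}:\mathbb N^{\mathbb N}\rightrightarrows\mathbb N^{\mathbb N}$, $\langle i,p\rangle\mapsto\{q:(\exists n)\ \varphi_i^p(n)\not\geq q(n)\}$. - $\mathrm{HYP}:\mathbb N^{\mathbb N}\rightrightarrows\mathbb N^{\mathbb N}$, $p\mapsto\{q:(\forall r\in\mathbb N^{\mathbb N},\ r\leq_{\mathrm T}p)(\exists n)\ r(n)<q(n)\}$. - $\mathrm{NON}:\mathbb N^{\mathbb N}\rightrightarrows\mathbb N^{\mathbb N}$, $p\mapsto\{q:q\not\leq_{\mathrm T}p\}$. - $\mathrm{DIS}:\mathbb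 N^{\mathbb N}\rightrightarrows\mathbb N^{\mathbb N}$, $p\mapsto\{q:\mathrm U(p)\neq q\}$ (every $q$ is a solution if $\mathrm U(p)$ is undefined), where $\mathrm U\langle\langle i,r\rangle,p\rangle:=\varphi_i^{\langle r,p\rangle}$ if this function is total and undefined otherwise ($i\in\mathbb N$, $r,p\in\mathbb N^{\mathbb N}$). *)

theory Defs
  imports Main "HOL-Library.Nat_Bijection" "HOL-Library.Infinite_Set"
begin

section \<open>Pairing\<close>

type_synonym baire = "nat \<Rightarrow> nat"

definition cpair :: "nat \<Rightarrow> nat \<Rightarrow> nat" where
  "cpair n k = (n + k) * (n + k + 1) div 2 + k"

definition cfst :: "nat \<Rightarrow> nat" where "cfst z = snd (prod_decode z)"
definition csnd :: "nat \<Rightarrow> nat" where "csnd z = fst (prod_decode z)"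

lemma cpair_eq_prod_encode: "cpair n k = prod_encode (k, n)"
  by (simp add: cpair_def prod_encode_def triangle_def add.commute)

lemma cfst_cpair [simp]: "cfst (cpair n k) = n"
  and csnd_cpair [simp]: "csnd (cpair n k) = k"
  and cpair_cfst_csnd [simp]: "cpair (cfst z) (csnd z) = z"
  by (simp_all add: cfst_def csnd_def cpair_eq_prod_encode)

lemma cpair_inject [simp]: "cpair a b = cpair c d \<longleftrightarrow> a = c \<and> b = d"
  by (metis cfst_cpair csnd_cpair)

definition join :: "baire \<Rightarrow> baire \<Rightarrow> baire" where
  "join p q n = (if even n then p (n div 2) else q (n div 2))"

definition evens :: "baire \<Rightarrow> baire" where "evens p n = p (2 * n)"
definition odds :: "baire \<Rightarrow> baire" where "odds p n = p (2 * n + 1)"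

lemma evens_join [simp]: "evens (join p q) = p"
  and odds_join [simp]: "odds (join p q) = q"
  by (auto simp: evens_def odds_def join_def)

lemma join_evens_odds [simp]: "join (evens p) (odds p) = p"
  by (rule ext) (auto simp: evens_def odds_def join_def)

text \<open>The concatenation \<open>ip\<close>, which is how a number and a point of Baire space are paired.\<close>

definition ncons :: "nat \<Rightarrow> baire \<Rightarrow> baire" where
  "ncons i p n = (case n of 0 \<Rightarrow> i | Suc m \<Rightarrow> p m)"

definition ntl :: "baire \<Rightarrow> baire" where "ntl p n = p (Suc n)"

lemma ncons_0 [simp]: "ncons i p 0 = i"
  and ntl_ncons [simp]: "ntl (ncons i p) = p"
  and ncons_ntl [simp]: "ncons (x 0) (ntl x) = x"
  by (auto simp: ncons_def ntl_def split: nat.splits)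

section \<open>Computability relative to an oracle\<close>

text \<open>Kleene's \<open>\<mu>\<close>-recursive functions with the oracle as an additional basic function.  All
  functions are unary; several arguments are coded into one by \<open>cpair\<close>.\<close>

datatype code =
    RZero | RSucc | RFst | RSnd | ROracle
  | RPair code code | RComp code code | RPrec code code | RMu code

primrec run :: "baire \<Rightarrow> code \<Rightarrow> nat \<Rightarrow> nat option" where
  "run p RZero n = Some 0"
| "run p RSucc n = Some (Suc n)"
| "run p RFst n = Some (cfst n)"
| "run p RSnd n = Some (csnd n)"
| "run p ROracle n = Some (p n)"
| "run p (RPair c d) n =
     Option.bind (run p c n) (\<lambda>a. Option.bind (run p d n) (\<lambda>b. Some (cpair a b)))"
| "run p (RComp c d) n = Option.bind (run p d n) (run p c)"
| "run p (RPrec c d) n =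
     rec_nat (run p c (cfst n))
       (\<lambda>k r. Option.bind r (\<lambda>a. run p d (cpair (cfst n) (cpair k a)))) (csnd n)"
| "run p (RMu c) n =
     (if \<exists>m. run p c (cpair n m) = Some 0 \<and> (\<forall>k<m. run p c (cpair n k) \<noteq> None)
      then Some (LEAST m. run p c (cpair n m) = Some 0) else None)"

text \<open>An effective bijective coding of programs by numbers gives the numbering
  \<open>i \<mapsto> \<phi>\<^sub>i\<^sup>p\<close>.\<close>

primrec encode :: "code \<Rightarrow> nat" where
  "encode RZero = 0"
| "encode RSucc = 1"
| "encode RFst = 2"
| "encode RSnd = 3"
| "encode ROracle = 4"
| "encode (RPair c d) = 5 + 4 * cpair (encode c) (encode d)"
| "encode (RComp c d) = 6 + 4 * cpair (encode c) (encode d)"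
| "encode (RPrec c d) = 7 + 4 * cpair (encode c) (encode d)"
| "encode (RMu c) = 8 + 4 * encode c"

lemma encode_mod_4:
  "encode c mod 4 =
     (case c of RZero \<Rightarrow> 0 | RSucc \<Rightarrow> 1 | RFst \<Rightarrow> 2 | RSnd \<Rightarrow> 3 | ROracle \<Rightarrow> 0
      | RPair _ _ \<Rightarrow> 1 | RComp _ _ \<Rightarrow> 2 | RPrec _ _ \<Rightarrow> 3 | RMu _ \<Rightarrow> 0)"
proof -
  have "(5 + 4 * z) mod 4 = 1" "(6 + 4 * z) mod 4 = 2" "(7 + 4 * z) mod 4 = 3"
    "(8 + 4 * z) mod 4 = 0" for z :: nat by presburger+
  then show ?thesis by (cases c) (simp_all only: encode.simps code.case, simp_all)
qed

lemma inj_encode: "inj encode"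
proof (rule injI)
  show "encode c = encode d \<Longrightarrow> c = d" for c d
  proof (induction c arbitrary: d)
    case (RPair c1 c2)
    have "(case d of RZero \<Rightarrow> 0 | RSucc \<Rightarrow> 1 | RFst \<Rightarrow> 2 | RSnd \<Rightarrow> 3 | ROracle \<Rightarrow> 0
      | RPair _ _ \<Rightarrow> 1 | RComp _ _ \<Rightarrow> 2 | RPrec _ _ \<Rightarrow> 3 | RMu _ \<Rightarrow> 0) = (1::nat)"
      using encode_mod_4[of "RPair c1 c2"] encode_mod_4[of d] RPair.prems by (simp only: code.case)
    with RPair show ?case by (cases d) auto
  next
    case (RComp c1 c2)
    have "(case d of RZero \<Rightarrow> 0 | RSucc \<Rightarrow> 1 | RFst \<Rightarrow> 2 | RSnd \<Rightarrow> 3 | ROracle \<Rightarrow> 0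
      | RPair _ _ \<Rightarrow> 1 | RComp _ _ \<Rightarrow> 2 | RPrec _ _ \<Rightarrow> 3 | RMu _ \<Rightarrow> 0) = (2::nat)"
      using encode_mod_4[of "RComp c1 c2"] encode_mod_4[of d] RComp.prems by (simp only: code.case)
    with RComp show ?case by (cases d) auto
  next
    case (RPrec c1 c2)
    have "(case d of RZero \<Rightarrow> 0 | RSucc \<Rightarrow> 1 | RFst \<Rightarrow> 2 | RSnd \<Rightarrow> 3 | ROracle \<Rightarrow> 0
      | RPair _ _ \<Rightarrow> 1 | RComp _ _ \<Rightarrow> 2 | RPrec _ _ \<Rightarrow> 3 | RMu _ \<Rightarrow> 0) = (3::nat)"
      using encode_mod_4[of "RPrec c1 c2"] encode_mod_4[of d] RPrec.prems by (simp only: code.case)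
    with RPrec show ?case by (cases d) auto
  next
    case (RMu c)
    have "(case d of RZero \<Rightarrow> 0 | RSucc \<Rightarrow> 1 | RFst \<Rightarrow> 2 | RSnd \<Rightarrow> 3 | ROracle \<Rightarrow> 0
      | RPair _ _ \<Rightarrow> 1 | RComp _ _ \<Rightarrow> 2 | RPrec _ _ \<Rightarrow> 3 | RMu _ \<Rightarrow> 0) = (0::nat)"
      using encode_mod_4[of "RMu c"] encode_mod_4[of d] RMu.prems by (simp only: code.case)
    with RMu show ?case by (cases d) auto
  qed (case_tac d; simp)+
qed

lemma cfst_le: "cfst z \<le> z" and csnd_le: "csnd z \<le> z"
  using le_prod_encode_1 le_prod_encode_2 by (metis cpair_cfst_csnd cpair_eq_prod_encode)+

lemma surj_encode: "surj encode"
proof -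
  have "\<exists>c. encode c = n" for n
  proof (induction n rule: less_induct)
    case (less n)
    consider "n = 0" | "n = 1" | "n = 2" | "n = 3" | "n = 4" | "n \<ge> 5" by linarith
    then show ?case
    proof cases
      case 6
      define z where "z = (n - 5) div 4"
      have z: "z < n" using 6 by (simp add: z_def)
      obtain c d e where cde: "encode c = cfst z" "encode d = csnd z" "encode e = z"
        using less z cfst_le[of z] csnd_le[of z] by (meson le_less_trans)
      have "n = 5 + 4 * z \<or> n = 6 + 4 * z \<or> n = 7 + 4 * z \<or> n = 8 + 4 * z"
        using 6 unfolding z_def by presburger
      moreover have "encode (RPair c d) = 5 + 4 * z" "encode (RComp c d) = 6 + 4 * z"
        "encode (RPrec c d) = 7 + 4 * z" "encode (RMu e) = 8 + 4 * z"
        by (simp_all add: cde)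
      ultimately show ?thesis by metis
    next
      case 1 then show ?thesis by (intro exI[of _ RZero]) simp
    next
      case 2 then show ?thesis by (intro exI[of _ RSucc]) simp
    next
      case 3 then show ?thesis by (intro exI[of _ RFst]) simp
    next
      case 4 then show ?thesis by (intro exI[of _ RSnd]) simp
    next
      case 5 then show ?thesis by (intro exI[of _ ROracle]) simp
    qed
  qed
  then show ?thesis by (metis surjI)
qed

lemma bij_encode: "bij encode"
  by (simp add: bij_def inj_encode surj_encode)

definition phi :: "baire \<Rightarrow> nat \<Rightarrow> nat \<Rightarrow> nat option" where
  "phi p i = run p (inv encode i)"

lemma phi_encode [simp]: "phi p (encode c) = run p c"
  by (simp add: phi_def inj_encode)

definition turing_le :: "baire \<Rightarrow> baire \<Rightarrow> bool" (infix "\<le>\<^sub>T" 50) where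
  "q \<le>\<^sub>T p \<longleftrightarrow> (\<exists>i. \<forall>n. phi p i n = Some (q n))"

text \<open>A computation of a partial function \<open>F\<close> on Baire space may also converge outside the
  domain of \<open>F\<close>.\<close>

definition computable :: "(baire \<Rightarrow> baire option) \<Rightarrow> bool" where
  "computable F \<longleftrightarrow> (\<exists>i. \<forall>p q. F p = Some q \<longrightarrow> (\<forall>n. phi p i n = Some (q n)))"

lemma turing_refl: "p \<le>\<^sub>T p"
  unfolding turing_le_def
  by (rule exI[of _ "encode ROracle"]) (simp del: encode.simps)

section \<open>Represented spaces and problems\<close>

text \<open>A represented space is given by its representation; the underlying set is \<open>ran \<delta>\<close>.\<close>

type_synonym 'a rep = "baire \<Rightarrow> 'a option"

text \<open>A partial multi-valued function assigns the empty set to the points outside its domain.\<close>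

record ('a, 'b) problem =
  in_rep :: "'a rep"
  out_rep :: "'b rep"
  sol :: "'a \<Rightarrow> 'b set"

definition pdom :: "('a, 'b) problem \<Rightarrow> 'a set" where
  "pdom f = {x. sol f x \<noteq> {}}"

definition realizer :: "(baire \<Rightarrow> baire option) \<Rightarrow> ('a, 'b) problem \<Rightarrow> bool" where
  "realizer F f \<longleftrightarrow>
     (\<forall>p x. in_rep f p = Some x \<and> x \<in> pdom f \<longrightarrow>
       (\<exists>q y. F p = Some q \<and> out_rep f q = Some y \<and> y \<in> sol f x))"

definition is_problem :: "('a, 'b) problem \<Rightarrow> bool" where
  "is_problem f \<longleftrightarrow>
     pdom f \<subseteq> ran (in_rep f) \<and> (\<forall>x. sol f x \<subseteq> ran (out_rep f)) \<and> (\<exists>F. realizer F f)"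

definition weihrauch_le :: "('a, 'b) problem \<Rightarrow> ('c, 'd) problem \<Rightarrow> bool"
    (infix "\<le>\<^sub>W" 50) where
  "f \<le>\<^sub>W g \<longleftrightarrow>
     (\<exists>H K. computable H \<and> computable K \<and>
       (\<forall>G. realizer G g \<longrightarrow>
         realizer (\<lambda>p. Option.bind (K p) (\<lambda>k. Option.bind (G k) (\<lambda>q. H (join p q)))) f))"

definition strong_weihrauch_le :: "('a, 'b) problem \<Rightarrow> ('c, 'd) problem \<Rightarrow> bool"
    (infix "\<le>\<^sub>s\<^sub>W" 50) where
  "f \<le>\<^sub>s\<^sub>W g \<longleftrightarrow>
     (\<exists>H K. computable H \<and> computable K \<and>
       (\<forall>G. realizer G g \<longrightarrow>
         realizer (\<lambda>p. Option.bind (K p) (\<lambda>k. Option.bind (G k) H)) f))"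

definition weihrauch_equiv :: "('a, 'b) problem \<Rightarrow> ('c, 'd) problem \<Rightarrow> bool"
    (infix "\<equiv>\<^sub>W" 50) where
  "f \<equiv>\<^sub>W g \<longleftrightarrow> f \<le>\<^sub>W g \<and> g \<le>\<^sub>W f"

definition strong_weihrauch_equiv :: "('a, 'b) problem \<Rightarrow> ('c, 'd) problem \<Rightarrow> bool"
    (infix "\<equiv>\<^sub>s\<^sub>W" 50) where
  "f \<equiv>\<^sub>s\<^sub>W g \<longleftrightarrow> f \<le>\<^sub>s\<^sub>W g \<and> g \<le>\<^sub>s\<^sub>W f"

definition weihrauch_less :: "('a, 'b) problem \<Rightarrow> ('c, 'd) problem \<Rightarrow> bool"
    (infix "<\<^sub>W" 50) where
  "f <\<^sub>W g \<longleftrightarrow> f \<le>\<^sub>W g \<and> \<not> g \<le>\<^sub>W f"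

definition baire_rep :: "baire rep" where "baire_rep p = Some p"
definition nat_rep :: "nat rep" where "nat_rep p = Some (p 0)"

definition seq_proj :: "baire \<Rightarrow> nat \<Rightarrow> baire" where
  "seq_proj p n k = p (cpair n k)"

definition seq_rep :: "'a rep \<Rightarrow> (nat \<Rightarrow> 'a) rep" where
  "seq_rep d p =
     (if \<forall>n. d (seq_proj p n) \<noteq> None then Some (\<lambda>n. the (d (seq_proj p n))) else None)"

text \<open>The partial map \<open>p \<mapsto> p - 1\<close>: zeros are deleted and all other entries decremented.  A finite
  word \<open>p - 1\<close> is never a name, so it is rendered as \<open>None\<close>.\<close>

definition minus_one :: "baire \<Rightarrow> baire option" where
  "minus_one p =
     (if infinite {n. p n \<noteq> 0} then Some (\<lambda>k. p (enumerate {n. p n \<noteq> 0} k) - 1) else None)"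

text \<open>In the completion, the points of the space are \<open>Some y\<close>, and the value \<open>None\<close> of type
  \<^typ>\<open>'a option\<close> is the added point \<open>\<bottom>\<close>; the representation itself is total.\<close>

definition completion_rep :: "'a rep \<Rightarrow> 'a option rep" where
  "completion_rep d p = Some (Option.bind (minus_one p) d)"

definition parallelization :: "('a, 'b) problem \<Rightarrow> (nat \<Rightarrow> 'a, nat \<Rightarrow> 'b) problem"
    ("\<Pi>\<^sub>P") where
  "\<Pi>\<^sub>P f =
     \<lparr>in_rep = seq_rep (in_rep f), out_rep = seq_rep (out_rep f),
      sol = (\<lambda>x. if \<forall>n. x n \<in> pdom f then {y. \<forall>n. y n \<in> sol f (x n)} else {})\<rparr>"

definition stashing :: "('a, 'b) problem \<Rightarrow> (nat \<Rightarrow> 'a, nat \<Rightarrow> 'b option) problem"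
    ("\<Sigma>\<^sub>P") where
  "\<Sigma>\<^sub>P f =
     \<lparr>in_rep = seq_rep (in_rep f), out_rep = seq_rep (completion_rep (out_rep f)),
      sol = (\<lambda>x. if \<forall>n. x n \<in> pdom f
        then {y. (\<forall>n. y n \<in> ran (completion_rep (out_rep f))) \<and>
                 (\<exists>n. \<exists>z \<in> sol f (x n). y n = Some z)}
        else {})\<rparr>"

definition deg :: "baire \<Rightarrow> baire set" where
  "deg p = {q. q \<le>\<^sub>T p \<and> p \<le>\<^sub>T q}"

definition degree_rep :: "baire set rep" where
  "degree_rep p = Some (deg p)"

definition degree_version :: "('a, 'b) problem \<Rightarrow> ('a, baire set) problem"
    ("_\<^sup>D" [1000] 1000) where
  "f\<^sup>D =
     \<lparr>in_rep = in_rep f, out_rep = degree_rep,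
      sol = (\<lambda>x. {deg q |q. \<exists>y \<in> sol f x. \<exists>r. out_rep f r = Some y \<and> r \<le>\<^sub>T q})\<rparr>"

section \<open>The problems\<close>

definition not_geq :: "nat option \<Rightarrow> nat \<Rightarrow> bool" where
  "not_geq v k \<longleftrightarrow> (case v of None \<Rightarrow> True | Some m \<Rightarrow> m < k)"

definition NGEQ :: "(baire, nat) problem" where
  "NGEQ = \<lparr>in_rep = baire_rep, out_rep = nat_rep,
     sol = (\<lambda>x. {k. not_geq (phi (ntl x) (cfst (x 0)) (csnd (x 0))) k})\<rparr>"

definition NMAJ :: "(baire, baire) problem" where
  "NMAJ = \<lparr>in_rep = baire_rep, out_rep = baire_rep,
     sol = (\<lambda>x. {q. \<exists>n. not_geq (phi (ntl x) (x 0) n) (q n)})\<rparr>"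

definition HYP :: "(baire, baire) problem" where
  "HYP = \<lparr>in_rep = baire_rep, out_rep = baire_rep,
     sol = (\<lambda>p. {q. \<forall>r. r \<le>\<^sub>T p \<longrightarrow> (\<exists>n. r n < q n)})\<rparr>"

definition NON :: "(baire, baire) problem" where
  "NON = \<lparr>in_rep = baire_rep, out_rep = baire_rep, sol = (\<lambda>p. {q. \<not> q \<le>\<^sub>T p})\<rparr>"

definition U :: "baire \<Rightarrow> baire option" where
  "U x = (let i = evens x 0; r = ntl (evens x); p = odds x; f = phi (join r p) i
          in if \<forall>n. f n \<noteq> None then Some (\<lambda>n. the (f n)) else None)"

definition DIS :: "(baire, baire) problem" where
  "DIS = \<lparr>in_rep = baire_rep, out_rep = baire_rep, sol = (\<lambda>p. {q. U p \<noteq> Some q})\<rparr>"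

section \<open>Basic properties\<close>

lemma sol_NGEQ: "sol NGEQ (ncons (cpair i n) p) = {k. not_geq (phi p i n) k}"
  by (simp add: NGEQ_def)

lemma sol_NMAJ: "sol NMAJ (ncons i p) = {q. \<exists>n. not_geq (phi p i n) (q n)}"
  by (simp add: NMAJ_def)

lemma U_join:
  "U (join (ncons i r) p) = Some q \<longleftrightarrow> (\<forall>n. phi (join r p) i n = Some (q n))"
proof
  assume "U (join (ncons i r) p) = Some q"
  then have "\<forall>n. phi (join r p) i n \<noteq> None" "q = (\<lambda>n. the (phi (join r p) i n))"
    by (simp_all add: U_def Let_def split: if_splits)
  then show "\<forall>n. phi (join r p) i n = Some (q n)" by simp
qed (simp add: U_def Let_def)

lemma ran_baire_rep [simp]: "ran baire_rep = UNIV"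
  by (auto simp: ran_def baire_rep_def)

lemma ran_nat_rep [simp]: "ran nat_rep = UNIV"
  by (auto simp: ran_def nat_rep_def intro: exI[of _ "\<lambda>_. _"])

lemma ran_seq_rep:
  fixes d :: "'a rep"
  shows "ran (seq_rep d) = {x. \<forall>n. x n \<in> ran d}"
proof (intro equalityI subsetI)
  fix x :: "nat \<Rightarrow> 'a" assume "x \<in> ran (seq_rep d)"
  then obtain p where p: "seq_rep d p = Some x" by (auto simp: ran_def)
  then have "\<forall>n. d (seq_proj p n) \<noteq> None" "x = (\<lambda>n. the (d (seq_proj p n)))"
    by (simp_all add: seq_rep_def split: if_splits)
  then have "d (seq_proj p n) = Some (x n)" for n by simp
  then show "x \<in> {x. \<forall>n. x n \<in> ran d}" by (auto simp: ran_def)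
next
  fix x :: "nat \<Rightarrow> 'a" assume "x \<in> {x. \<forall>n. x n \<in> ran d}"
  then obtain P where P: "\<And>n. d (P n) = Some (x n)"
    by (simp add: ran_def) metis
  have "seq_proj (\<lambda>z. P (cfst z) (csnd z)) = P"
    by (simp add: seq_proj_def fun_eq_iff)
  then have "seq_rep d (\<lambda>z. P (cfst z) (csnd z)) = Some x"
    by (simp add: seq_rep_def P)
  then show "x \<in> ran (seq_rep d)" by (auto simp: ran_def)
qed

lemma minus_one_Suc: "minus_one (\<lambda>k. Suc (p k)) = Some p"
proof -
  have "enumerate (UNIV :: nat set) k = k" for k
    by (induction k) (auto simp: enumerate_0 enumerate_Suc'' intro!: Least_equality)
  then show ?thesis by (simp add: minus_one_def)
qed

lemma ran_completion_rep: "ran (completion_rep d) = insert None (Some ` ran d)"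
proof (intro equalityI subsetI)
  fix y assume "y \<in> ran (completion_rep d)"
  then show "y \<in> insert None (Some ` ran d)"
    by (cases y) (auto simp: ran_def completion_rep_def bind_eq_Some_conv)
next
  fix y assume "y \<in> insert None (Some ` ran d)"
  moreover have "completion_rep d (\<lambda>_. 0) = Some None"
    by (simp add: completion_rep_def minus_one_def)
  moreover have "completion_rep d (\<lambda>k. Suc (p k)) = Some (d p)" for p
    by (simp add: completion_rep_def minus_one_Suc)
  ultimately show "y \<in> ran (completion_rep d)"
    unfolding ran_def by auto metis+
qed

lemma is_problemI:
  assumes "pdom f \<subseteq> ran (in_rep f)" and "\<And>x. sol f x \<subseteq> ran (out_rep f)"
  shows "is_problem f"
proof -
  have "\<exists>q y. out_rep f q = Some y \<and> y \<in> sol f x" if "x \<in> pdom f" for x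
    using that assms(2)[of x] by (fastforce simp: pdom_def ran_def)
  then obtain Q where "\<And>x. x \<in> pdom f \<Longrightarrow> \<exists>y. out_rep f (Q x) = Some y \<and> y \<in> sol f x"
    by metis
  then have "realizer (\<lambda>p. Some (Q (the (in_rep f p)))) f"
    by (simp add: realizer_def)
  then show ?thesis using assms by (auto simp: is_problem_def)
qed

lemma pdom_NGEQ: "pdom NGEQ = UNIV"
proof -
  have "\<exists>k. not_geq v k" for v by (cases v) (auto simp: not_geq_def)
  then show ?thesis by (simp add: pdom_def NGEQ_def)
qed

lemma pdom_NMAJ: "pdom NMAJ = UNIV"
proof -
  have "not_geq (phi (ntl x) (x 0) 0) (case phi (ntl x) (x 0) 0 of None \<Rightarrow> 0 | Some m \<Rightarrow> Suc m)"
    for x by (simp add: not_geq_def split: option.splits)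
  then have "(\<lambda>n. case phi (ntl x) (x 0) n of None \<Rightarrow> 0 | Some m \<Rightarrow> Suc m) \<in> sol NMAJ x" for x
    by (auto simp: NMAJ_def)
  then show ?thesis by (auto simp: pdom_def)
qed

lemma pdom_HYP: "pdom HYP = UNIV"
proof -
  have "\<exists>n. r n < Suc (the (phi p n n))" if "r \<le>\<^sub>T p" for p r
    using that unfolding turing_le_def by (metis lessI option.sel)
  then have "(\<lambda>n. Suc (the (phi p n n))) \<in> sol HYP p" for p
    by (simp add: HYP_def)
  then show ?thesis by (auto simp: pdom_def)
qed

lemma pdom_NON: "pdom NON = UNIV"
proof -
  have "\<not> (\<lambda>n. Suc (the (phi p n n))) \<le>\<^sub>T p" for p
    unfolding turing_le_def by (metis n_not_Suc_n option.sel)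
  then have "(\<lambda>n. Suc (the (phi p n n))) \<in> sol NON p" for p
    by (simp add: NON_def)
  then show ?thesis by (auto simp: pdom_def)
qed

lemma pdom_DIS: "pdom DIS = UNIV"
proof -
  have "U p \<noteq> Some (\<lambda>n. Suc (the (U p) n))" for p
    by (metis n_not_Suc_n option.sel)
  then have "\<exists>q. U p \<noteq> Some q" for p by blast
  then show ?thesis by (simp add: pdom_def DIS_def)
qed

lemma is_problem_basic:
  "is_problem NGEQ" "is_problem NMAJ" "is_problem HYP" "is_problem NON" "is_problem DIS"
  by (auto intro!: is_problemI simp: NGEQ_def NMAJ_def HYP_def NON_def DIS_def)

lemma pdom_parallelization: "pdom (\<Pi>\<^sub>P f) = {x. \<forall>n. x n \<in> pdom f}"
proof -
  have "\<exists>y. \<forall>n. y n \<in> sol f (x n)" if "\<forall>n. x n \<in> pdom f" for x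
  proof (rule choice)
    show "\<forall>n. \<exists>z. z \<in> sol f (x n)" using that by (auto simp: pdom_def)
  qed
  then show ?thesis by (auto simp: parallelization_def pdom_def split: if_splits)
qed

lemma is_problem_parallelization:
  assumes "is_problem f"
  shows "is_problem (\<Pi>\<^sub>P f)"
proof (rule is_problemI)
  show "pdom (\<Pi>\<^sub>P f) \<subseteq> ran (in_rep (\<Pi>\<^sub>P f))"
    using assms unfolding pdom_parallelization
    by (auto simp only: is_problem_def parallelization_def ran_seq_rep problem.simps)
  have "z \<in> ran (out_rep f)" if "z \<in> sol f x" for x z
    using that assms unfolding is_problem_def by blast
  then show "sol (\<Pi>\<^sub>P f) x \<subseteq> ran (out_rep (\<Pi>\<^sub>P f))" for x
    unfolding parallelization_def problem.simps ran_seq_rep by (simp split: if_splits) blast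
qed

lemma pdom_stashing:
  assumes "is_problem f"
  shows "pdom (\<Sigma>\<^sub>P f) = {x. \<forall>n. x n \<in> pdom f}"
proof -
  have "\<exists>y. (\<forall>n. y n \<in> ran (completion_rep (out_rep f))) \<and>
          (\<exists>n. \<exists>z \<in> sol f (x n). y n = Some z)" if "\<forall>n. x n \<in> pdom f" for x :: "nat \<Rightarrow> _"
  proof -
    have "sol f (x 0) \<noteq> {}" using that by (simp add: pdom_def)
    then obtain z where z: "z \<in> sol f (x 0)" by blast
    then have "Some z \<in> ran (completion_rep (out_rep f))"
      using assms by (auto simp: ran_completion_rep is_problem_def)
    with z show ?thesis by (intro exI[of _ "\<lambda>_. Some z"]) auto
  qed
  then show ?thesis by (auto simp: stashing_def pdom_def split: if_splits)
qed

lemma is_problem_stashing: "is_problem f \<Longrightarrow> is_problem (\<Sigma>\<^sub>P f)"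
  by (rule is_problemI)
     (simp_all only: pdom_stashing,
      auto simp: stashing_def ran_seq_rep is_problem_def split: if_splits)

lemma pdom_degree_version:
  assumes "is_problem f"
  shows "pdom (f\<^sup>D) = pdom f"
proof -
  have "deg q \<in> sol (f\<^sup>D) x" if "y \<in> sol f x" "out_rep f q = Some y" for x y q
    using that turing_refl[of q] by (auto simp: degree_version_def)
  moreover have "\<exists>q. out_rep f q = Some y" if "y \<in> sol f x" for x y
  proof -
    have "y \<in> ran (out_rep f)" using that assms unfolding is_problem_def by blast
    then show ?thesis by (simp add: ran_def)
  qed
  moreover have "sol f x \<noteq> {}" if "d \<in> sol (f\<^sup>D) x" for x d
    using that by (auto simp: degree_version_def)
  ultimately show ?thesis unfolding pdom_def by blast
qed

lemma is_problem_degree_version: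
  assumes "is_problem f"
  shows "is_problem (f\<^sup>D)"
proof (rule is_problemI)
  show "pdom (f\<^sup>D) \<subseteq> ran (in_rep (f\<^sup>D))"
    using assms by (simp add: pdom_degree_version) (simp add: degree_version_def is_problem_def)
  show "sol (f\<^sup>D) x \<subseteq> ran (out_rep (f\<^sup>D))" for x
    by (auto simp: degree_version_def degree_rep_def ran_def)
qed

end

theory Submission
  imports Defs
begin

text \<open>All positive statements come from explicit reductions.  \<open>DIS\<close> can decide, at one place of a
  stash, whether a computation halts, and this solves \<open>NGEQ\<close> and \<open>NMAJ\<close> there.  \<open>NMAJ\<close> does not reduce
  to \<open>DIS\<close>, since a program that knows its own index computes enough candidate answers of a supposed
  reduction to dominate one of the correct ones.  \<open>HYP\<close> does not reduce to \<open>NMAJ\<close>, since every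
  instance of \<open>NMAJ\<close> has a solution computable in the instance.  \<open>HYP\<^sup>D\<close> does not reduce to \<open>NON\<close>, since
  there is a noncomputable set of hyperimmune-free degree.\<close>

section \<open>Functions computable uniformly in the oracle\<close>

text \<open>A reduction has to cope with every answer of its target, so each lower bound needs only
  one bad instance and one well chosen answer. The obstacle in the upper bounds is that names are
  infinite sequences while the computations at stake may diverge. Completions resolve this: zeros in
  a name buy time, and a wait that never ends spoils only its own component of the stash, where a
  single good component suffices. The noncomputable set comes from the hyperimmune-free basis
  theorem of Jockusch and Soare, whose engine is the compactness of Cantor space.

  Universality, dovetailing and the use principle are all obtained from one decidable predicate on
  finite certificates. Equality in \<open>computable_pfun\<close> includes divergence, because
  halting and non-halting themselves carry information in the searches and in the \<Pi>01
  classes.\<close>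

definition computable_pfun :: "(baire \<Rightarrow> nat \<Rightarrow> nat option) \<Rightarrow> bool" where
  "computable_pfun f \<longleftrightarrow> (\<exists>c. \<forall>p n. run p c n = f p n)"

definition computable_fun :: "(baire \<Rightarrow> nat \<Rightarrow> nat) \<Rightarrow> bool" where
  "computable_fun f \<longleftrightarrow> computable_pfun (\<lambda>p n. Some (f p n))"

definition computable_pred :: "(baire \<Rightarrow> nat \<Rightarrow> bool) \<Rightarrow> bool" where
  "computable_pred P \<longleftrightarrow> computable_fun (\<lambda>p n. of_bool (P p n))"

lemma computable_pfunI: "(\<And>p n. run p c n = f p n) \<Longrightarrow> computable_pfun f"
  by (auto simp: computable_pfun_def)

lemma computable_funI: "(\<And>p n. run p c n = Some (f p n)) \<Longrightarrow> computable_fun f"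
  by (auto simp: computable_fun_def computable_pfun_def)

lemma computable_pfun_run: "computable_pfun (\<lambda>p. run p c)"
  by (auto simp: computable_pfun_def)

named_theorems computable_intros

lemma computable_fun_Some [computable_intros]:
  "computable_fun f \<Longrightarrow> computable_pfun (\<lambda>p n. Some (f p n))"
  by (simp add: computable_fun_def)

text \<open>The identity is not a basic program; splitting a number and pairing its components again
  restores it.\<close>

lemma computable_fun_id [computable_intros]: "computable_fun (\<lambda>p n. n)"
  by (rule computable_funI[of "RPair RFst RSnd"]) simp

lemma computable_fun_const [computable_intros]: "computable_fun (\<lambda>p n. k)"
proof (induction k)
  case 0
  show ?case by (rule computable_funI[of RZero]) simp
next
  case (Suc k)
  then obtain c where "\<And>p n. run p c n = Some k"
    unfolding computable_fun_def computable_pfun_def by blast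
  then show ?case by (intro computable_funI[of "RComp RSucc c"]) simp
qed

lemma computable_pfun_comp:
  assumes "computable_pfun g" "computable_fun f"
  shows "computable_pfun (\<lambda>p n. g p (f p n))"
proof -
  obtain c where "\<And>p n. run p c n = g p n" using assms(1) unfolding computable_pfun_def by blast
  moreover obtain d where "\<And>p n. run p d n = Some (f p n)"
    using assms(2) unfolding computable_fun_def computable_pfun_def by blast
  ultimately show ?thesis by (intro computable_pfunI[of "RComp c d"]) simp
qed

lemma computable_fun_comp:
  "computable_fun g \<Longrightarrow> computable_fun f \<Longrightarrow> computable_fun (\<lambda>p n. g p (f p n))"
  using computable_pfun_comp[of "\<lambda>p n. Some (g p n)"] by (simp add: computable_fun_def)

lemma computable_pred_comp:
  "computable_pred P \<Longrightarrow> computable_fun f \<Longrightarrow> computable_pred (\<lambda>p n. P p (f p n))"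
  unfolding computable_pred_def by (rule computable_fun_comp)

lemma computable_fun_Suc [computable_intros]:
  "computable_fun f \<Longrightarrow> computable_fun (\<lambda>p n. Suc (f p n))"
  by (rule computable_fun_comp[of "\<lambda>p n. Suc n"]) (rule computable_funI[of RSucc], simp)

lemma computable_fun_cfst [computable_intros]:
  "computable_fun f \<Longrightarrow> computable_fun (\<lambda>p n. cfst (f p n))"
  by (rule computable_fun_comp[of "\<lambda>p n. cfst n"]) (rule computable_funI[of RFst], simp)

lemma computable_fun_csnd [computable_intros]:
  "computable_fun f \<Longrightarrow> computable_fun (\<lambda>p n. csnd (f p n))"
  by (rule computable_fun_comp[of "\<lambda>p n. csnd n"]) (rule computable_funI[of RSnd], simp)

lemma computable_fun_oracle [computable_intros]:
  "computable_fun f \<Longrightarrow> computable_fun (\<lambda>p n. p (f p n))"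
  by (rule computable_fun_comp[of "\<lambda>p n. p n"]) (rule computable_funI[of ROracle], simp)

lemma computable_fun_cpair [computable_intros]:
  assumes "computable_fun f" "computable_fun g"
  shows "computable_fun (\<lambda>p n. cpair (f p n) (g p n))"
proof -
  obtain c where "\<And>p n. run p c n = Some (f p n)"
    using assms(1) unfolding computable_fun_def computable_pfun_def by blast
  moreover obtain d where "\<And>p n. run p d n = Some (g p n)"
    using assms(2) unfolding computable_fun_def computable_pfun_def by blast
  ultimately show ?thesis by (intro computable_funI[of "RPair c d"]) simp
qed

text \<open>Programs are unary, so a bound variable becomes a component of a coded pair: the premise
  on \<open>g p (cfst z) (csnd z)\<close> treats \<open>g\<close> as a function of two numbers. The
  same form recurs in all rules with binders.\<close>

lemma computable_pfun_bind:
  assumes "computable_pfun f" "computable_pfun (\<lambda>p z. g p (cfst z) (csnd z))"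
  shows "computable_pfun (\<lambda>p n. Option.bind (f p n) (\<lambda>v. g p n v))"
proof -
  obtain c where "\<And>p n. run p c n = f p n" using assms(1) unfolding computable_pfun_def by blast
  moreover obtain d where "\<And>p z. run p d z = g p (cfst z) (csnd z)"
    using assms(2) unfolding computable_pfun_def by blast
  ultimately show ?thesis
    by (intro computable_pfunI[of "RComp d (RPair (RPair RFst RSnd) c)"])
      (simp add: bind_eq_Some_conv split: Option.bind_split)
qed

lemma computable_fun_rec_nat [computable_intros]:
  assumes "computable_fun a" "computable_fun (\<lambda>p z. g p (cfst z) (cfst (csnd z)) (csnd (csnd z)))"
    "computable_fun b"
  shows "computable_fun (\<lambda>p n. rec_nat (a p n) (\<lambda>k r. g p n k r) (b p n))"
proof -
  obtain c where c: "\<And>p n. run p c n = Some (a p n)"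
    using assms(1) unfolding computable_fun_def computable_pfun_def by blast
  obtain d where d: "\<And>p z. run p d z = Some (g p (cfst z) (cfst (csnd z)) (csnd (csnd z)))"
    using assms(2) unfolding computable_fun_def computable_pfun_def by blast
  have "run p (RPrec c d) (cpair n k) = Some (rec_nat (a p n) (\<lambda>k r. g p n k r) k)" for p n k
    by (induction k) (simp_all add: c d)
  then have "computable_fun (\<lambda>p z. rec_nat (a p (cfst z)) (\<lambda>k r. g p (cfst z) k r) (csnd z))"
    by (intro computable_funI[of "RPrec c d"]) (metis cpair_cfst_csnd)
  from computable_fun_comp[OF this computable_fun_cpair[OF computable_fun_id assms(3)]]
  show ?thesis by simp
qed

lemma computable_fun_diff_one [computable_intros]:
  assumes "computable_fun f"
  shows "computable_fun (\<lambda>p n. f p n - 1)"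
proof -
  have "rec_nat 0 (\<lambda>k r. k) m = m - 1" for m :: nat by (cases m) auto
  moreover have "computable_fun (\<lambda>p n. rec_nat 0 (\<lambda>k r. k) (f p n))"
    by (intro computable_intros assms)
  ultimately show ?thesis by simp
qed

lemma computable_fun_plus [computable_intros]:
  assumes "computable_fun f" "computable_fun g"
  shows "computable_fun (\<lambda>p n. f p n + g p n)"
proof -
  have "rec_nat a (\<lambda>k r. Suc r) b = a + b" for a b by (induction b) auto
  moreover have "computable_fun (\<lambda>p n. rec_nat (f p n) (\<lambda>k r. Suc r) (g p n))"
    by (intro computable_intros assms)
  ultimately show ?thesis by simp
qed

lemma computable_fun_times [computable_intros]:
  assumes "computable_fun f" "computable_fun g"
  shows "computable_fun (\<lambda>p n. f p n * g p n)"
proof -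
  have "rec_nat 0 (\<lambda>k r. r + a) b = a * b" for a b :: nat by (induction b) auto
  moreover have "computable_fun (\<lambda>p n. rec_nat 0 (\<lambda>k r. r + f p n) (g p n))"
    by (intro computable_intros assms computable_fun_comp[OF assms(1)])
  ultimately show ?thesis by simp
qed

lemma computable_fun_minus [computable_intros]:
  assumes "computable_fun f" "computable_fun g"
  shows "computable_fun (\<lambda>p n. f p n - g p n)"
proof -
  have "rec_nat a (\<lambda>k r. r - 1) b = a - b" for a b :: nat by (induction b) auto
  moreover have "computable_fun (\<lambda>p n. rec_nat (f p n) (\<lambda>k r. r - 1) (g p n))"
    by (intro computable_intros assms)
  ultimately show ?thesis by simp
qed

lemma computable_fun_power2 [computable_intros]:
  assumes "computable_fun f"
  shows "computable_fun (\<lambda>p n. 2 ^ f p n)"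
proof -
  have "rec_nat 1 (\<lambda>k r. 2 * r) b = (2::nat) ^ b" for b by (induction b) auto
  moreover have "computable_fun (\<lambda>p n. rec_nat 1 (\<lambda>k r. 2 * r) (f p n))"
    by (intro computable_intros assms)
  ultimately show ?thesis by simp
qed

lemma computable_fun_div2 [computable_intros]:
  assumes "computable_fun f"
  shows "computable_fun (\<lambda>p n. f p n div 2)"
proof -
  \<comment> \<open>The two halves of \<open>b\<close>, rounded down and up, add up to
    \<open>b\<close>; so halving obeys the recursion that sends \<open>k\<close> and
    \<open>r\<close> to \<open>k - r\<close>.\<close>
  have "b - b div 2 = Suc b div 2" for b :: nat by presburger
  then have "rec_nat 0 (\<lambda>k r. k - r) b = b div 2" for b :: nat
    by (induction b) simp_all
  moreover have "computable_fun (\<lambda>p n. rec_nat 0 (\<lambda>k r. k - r) (f p n))"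
    by (intro computable_intros assms)
  ultimately show ?thesis by simp
qed

lemma computable_pred_not [computable_intros]:
  assumes "computable_pred P"
  shows "computable_pred (\<lambda>p n. \<not> P p n)"
proof -
  have "computable_fun (\<lambda>p n. 1 - of_bool (P p n))"
    using assms unfolding computable_pred_def by (intro computable_intros)
  moreover have "1 - of_bool b = (of_bool (\<not> b) :: nat)" for b by simp
  ultimately show ?thesis by (simp add: computable_pred_def)
qed

lemma computable_pred_conj [computable_intros]:
  assumes "computable_pred P" "computable_pred Q"
  shows "computable_pred (\<lambda>p n. P p n \<and> Q p n)"
  using assms unfolding computable_pred_def of_bool_conj by (intro computable_intros)

lemma computable_pred_disj [computable_intros]:
  assumes "computable_pred P" "computable_pred Q"
  shows "computable_pred (\<lambda>p n. P p n \<or> Q p n)"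
proof -
  have "computable_pred (\<lambda>p n. \<not> (\<not> P p n \<and> \<not> Q p n))"
    by (intro computable_intros assms)
  then show ?thesis by simp
qed

lemma computable_pred_imp [computable_intros]:
  assumes "computable_pred P" "computable_pred Q"
  shows "computable_pred (\<lambda>p n. P p n \<longrightarrow> Q p n)"
  unfolding imp_conv_disj by (intro computable_intros assms)

lemma computable_pred_le [computable_intros]:
  assumes "computable_fun f" "computable_fun g"
  shows "computable_pred (\<lambda>p n. f p n \<le> g p n)"
proof -
  have "computable_fun (\<lambda>p n. 1 - (f p n - g p n))"
    by (intro computable_intros assms)
  moreover have "1 - (a - b) = of_bool (a \<le> b)" for a b :: nat by simp
  ultimately show ?thesis by (simp add: computable_pred_def)
qed

lemma computable_pred_less [computable_intros]:
  assumes "computable_fun f" "computable_fun g"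
  shows "computable_pred (\<lambda>p n. f p n < g p n)"
  unfolding less_eq_Suc_le by (intro computable_intros assms)

lemma computable_pred_eq [computable_intros]:
  assumes "computable_fun f" "computable_fun g"
  shows "computable_pred (\<lambda>p n. f p n = g p n)"
  unfolding eq_iff by (intro computable_intros assms)

lemma computable_pred_even [computable_intros]:
  assumes "computable_fun f"
  shows "computable_pred (\<lambda>p n. even (f p n))"
proof -
  have "computable_pred (\<lambda>p n. 2 * (f p n div 2) = f p n)"
    by (intro computable_intros assms)
  moreover have "2 * (m div 2) = m \<longleftrightarrow> even m" for m :: nat by presburger
  ultimately show ?thesis by simp
qed

text \<open>Arithmetic is enough because both branches are total. Where a branch may diverge,
  \<open>computable_pfun_guard\<close> or the choice of an index for \<open>phi\<close> takes
  over.\<close>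

lemma computable_fun_if [computable_intros]:
  assumes "computable_pred P" "computable_fun f" "computable_fun g"
  shows "computable_fun (\<lambda>p n. if P p n then f p n else g p n)"
proof -
  have "computable_fun (\<lambda>p n. of_bool (P p n) * f p n + of_bool (\<not> P p n) * g p n)"
    using assms(1) computable_pred_not[OF assms(1)] unfolding computable_pred_def
    by (intro computable_intros assms)
  moreover have "of_bool b * x + of_bool (\<not> b) * y = (if b then x else y)" for b and x y :: nat
    by simp
  ultimately show ?thesis by simp
qed

lemma computable_pred_all_less [computable_intros]:
  assumes "computable_fun b" "computable_pred (\<lambda>p z. P p (cfst z) (csnd z))"
  shows "computable_pred (\<lambda>p n. \<forall>k<b p n. P p n k)"
proof -
  \<comment> \<open>The step of the recursion also receives the accumulator as third component; it
    is projected away here.\<close>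
  have "computable_pred (\<lambda>p z. P p (cfst z) (cfst (csnd z)))"
    using computable_pred_comp[OF assms(2), of "\<lambda>p z. cpair (cfst z) (cfst (csnd z))"]
    by (simp add: computable_intros)
  then have "computable_fun (\<lambda>p n. rec_nat 1 (\<lambda>k r. if P p n k then r else 0) (b p n))"
    by (intro computable_intros assms)
  moreover have "of_bool (\<forall>k<m. Q k) = rec_nat (1::nat) (\<lambda>k r. if Q k then r else 0) m" for Q m
    by (induction m) (auto simp: less_Suc_eq)
  ultimately show ?thesis by (simp only: computable_pred_def)
qed

lemma computable_pred_ex_less [computable_intros]:
  assumes "computable_fun b" "computable_pred (\<lambda>p z. P p (cfst z) (csnd z))"
  shows "computable_pred (\<lambda>p n. \<exists>k<b p n. P p n k)"
proof -
  have "computable_pred (\<lambda>p n. \<not> (\<forall>k<b p n. \<not> P p n k))"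
    by (intro computable_intros assms)
  then show ?thesis by simp
qed

lemma computable_pfun_Least:
  assumes "computable_pred (\<lambda>p z. P p (cfst z) (csnd z))"
  shows "computable_pfun (\<lambda>p n. if \<exists>m. P p n m then Some (LEAST m. P p n m) else None)"
proof -
  \<comment> \<open>\<open>RMu\<close> looks for a zero, hence the negated characteristic function.
    Its totality settles the requirement of \<open>RMu\<close> on smaller arguments.\<close>
  have "computable_fun (\<lambda>p z. 1 - of_bool (P p (cfst z) (csnd z)))"
    using assms unfolding computable_pred_def by (intro computable_intros)
  then obtain c where c: "\<And>p z. run p c z = Some (1 - of_bool (P p (cfst z) (csnd z)))"
    unfolding computable_fun_def computable_pfun_def by blast
  then have "run p (RMu c) n = (if \<exists>m. P p n m then Some (LEAST m. P p n m) else None)" for p n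
    by (simp add: c of_bool_def)
  then show ?thesis by (rule computable_pfunI)
qed

section \<open>Substituting a computed oracle\<close>

text \<open>The substituted program receives a parameter \<open>a\<close> on which the new oracle may depend, as
  first component of its argument.\<close>

primrec subst_oracle :: "code \<Rightarrow> code \<Rightarrow> code" where
  "subst_oracle d RZero = RZero"
| "subst_oracle d RSucc = RComp RSucc RSnd"
| "subst_oracle d RFst = RComp RFst RSnd"
| "subst_oracle d RSnd = RComp RSnd RSnd"
| "subst_oracle d ROracle = d"
| "subst_oracle d (RPair c e) = RPair (subst_oracle d c) (subst_oracle d e)"
| "subst_oracle d (RComp c e) = RComp (subst_oracle d c) (RPair RFst (subst_oracle d e))"
| "subst_oracle d (RPrec c e) =
     RComp (RPrec (subst_oracle d c)
         (RComp (subst_oracle d e) (RPair (RComp RFst RFst) (RPair (RComp RSnd RFst) RSnd))))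
       (RPair (RPair RFst (RComp RFst RSnd)) (RComp RSnd RSnd))"
| "subst_oracle d (RMu c) =
     RMu (RComp (subst_oracle d c) (RPair (RComp RFst RFst) (RPair (RComp RSnd RFst) RSnd)))"

lemma run_subst_oracle:
  assumes "\<And>j. run p d (cpair a j) = Some (q j)"
  shows "run p (subst_oracle d c) (cpair a n) = run q c n"
proof (induction c arbitrary: n)
  case (RPrec c e)
  have "rec_nat (run p (subst_oracle d c) (cpair a x))
     (\<lambda>k r. Option.bind r (\<lambda>b. run p (subst_oracle d e) (cpair a (cpair x (cpair k b))))) m =
    rec_nat (run q c x) (\<lambda>k r. Option.bind r (\<lambda>b. run q e (cpair x (cpair k b)))) m" for x m
    by (simp add: RPrec)
  then show ?case by simp
qed (simp_all add: assms)

text \<open>The argument \<open>n\<close> itself is the parameter of the substitution, so the new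
  oracle may vary with the input and one program can treat a whole sequence of instances.\<close>

lemma computable_pfun_oracle:
  assumes "computable_pfun f" "computable_fun (\<lambda>p z. Q p (cfst z) (csnd z))" "computable_fun g"
  shows "computable_pfun (\<lambda>p n. f (\<lambda>j. Q p n j) (g p n))"
proof -
  obtain c where c: "\<And>p n. run p c n = f p n" using assms(1) unfolding computable_pfun_def by blast
  obtain d where d: "\<And>p z. run p d z = Some (Q p (cfst z) (csnd z))"
    using assms(2) unfolding computable_fun_def computable_pfun_def by blast
  have "run p (subst_oracle d c) (cpair n m) = f (\<lambda>j. Q p n j) m" for p n m
    by (subst run_subst_oracle[where q = "\<lambda>j. Q p n j"]) (simp_all add: c d)
  then have "computable_pfun (\<lambda>p z. f (\<lambda>j. Q p (cfst z) j) (csnd z))"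
    by (intro computable_pfunI[of "subst_oracle d c"]) (metis cpair_cfst_csnd)
  from computable_pfun_comp[OF this computable_fun_cpair[OF computable_fun_id assms(3)]]
  show ?thesis by simp
qed

lemma computable_fun_oracle_change:
  assumes "computable_fun f" "computable_fun (\<lambda>p z. Q p (cfst z) (csnd z))" "computable_fun g"
  shows "computable_fun (\<lambda>p n. f (\<lambda>j. Q p n j) (g p n))"
  using computable_pfun_oracle[of "\<lambda>p n. Some (f p n)" Q g] assms by (simp add: computable_fun_def)

lemma computable_pred_oracle_change:
  assumes "computable_pred P" "computable_fun (\<lambda>p z. Q p (cfst z) (csnd z))" "computable_fun g"
  shows "computable_pred (\<lambda>p n. P (\<lambda>j. Q p n j) (g p n))"
  using computable_fun_oracle_change[of "\<lambda>p n. of_bool (P p n)" Q g] assms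
  by (simp add: computable_pred_def)

section \<open>A decidable computation predicate\<close>

text \<open>Computations are certified by finite sets of triples \<open>(i, n, v)\<close>, each asserting
  \<open>\<phi>\<^sub>i\<^sup>p(n) = v\<close>, in which every triple follows from triples of the set in one
  evaluation step.  Certificates need no order: a derivation of a triple only uses triples with
  smaller programs or, for the same primitive recursion, a smaller recursion argument.\<close>

definition triple :: "nat \<Rightarrow> nat \<Rightarrow> nat \<Rightarrow> nat" where
  "triple i n v = cpair i (cpair n v)"

text \<open>The indices are the values of \<open>encode\<close>, so a step can be checked on numbers
  without decoding programs. In rule \<open>mu\<close>, positive values below \<open>v\<close>
  express both convergence and the absence of an earlier zero.\<close>

inductive justified :: "baire \<Rightarrow> nat set \<Rightarrow> nat \<Rightarrow> nat \<Rightarrow> nat \<Rightarrow> bool" for p S where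
  zero: "justified p S 0 n 0"
| succ: "justified p S (Suc 0) n (Suc n)"
| first: "justified p S 2 n (cfst n)"
| second: "justified p S 3 n (csnd n)"
| query: "justified p S 4 n (p n)"
| pair: "triple c n a \<in> S \<Longrightarrow> triple d n b \<in> S \<Longrightarrow> justified p S (5 + 4 * cpair c d) n (cpair a b)"
| comp: "triple d n a \<in> S \<Longrightarrow> triple c a v \<in> S \<Longrightarrow> justified p S (6 + 4 * cpair c d) n v"
| prec_zero: "triple c x v \<in> S \<Longrightarrow> justified p S (7 + 4 * cpair c d) (cpair x 0) v"
| prec_Suc: "triple (7 + 4 * cpair c d) (cpair x k) r \<in> S \<Longrightarrow>
    triple d (cpair x (cpair k r)) v \<in> S \<Longrightarrow> justified p S (7 + 4 * cpair c d) (cpair x (Suc k)) v"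
| mu: "triple c (cpair n v) 0 \<in> S \<Longrightarrow> \<forall>m<v. \<exists>r. triple c (cpair n m) (Suc r) \<in> S \<Longrightarrow>
    justified p S (8 + 4 * c) n v"

definition certificate :: "baire \<Rightarrow> nat set \<Rightarrow> bool" where
  "certificate p S \<longleftrightarrow> (\<forall>i n v. triple i n v \<in> S \<longrightarrow> justified p S i n v)"

lemma triple_inject [simp]: "triple i n v = triple j m w \<longleftrightarrow> i = j \<and> n = m \<and> v = w"
  by (simp add: triple_def)

lemma justified_mono: "justified p S i n v \<Longrightarrow> S \<subseteq> S' \<Longrightarrow> justified p S' i n v"
proof (induction rule: justified.induct)
  case (mu c n v)
  then have "\<forall>m<v. \<exists>r. triple c (cpair n m) (Suc r) \<in> S'" by (meson subsetD)
  with mu show ?case by (blast intro: justified.mu)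
qed (blast intro: justified.intros)+

lemma certificate_Union:
  assumes "\<And>S. S \<in> \<S> \<Longrightarrow> certificate p S" shows "certificate p (\<Union>\<S>)"
  using assms unfolding certificate_def by (meson Union_iff Union_upper justified_mono)

lemma certificate_insert:
  assumes "certificate p S" "justified p S i n v" shows "certificate p (insert (triple i n v) S)"
  using assms unfolding certificate_def
  by (metis insert_iff justified_mono subset_insertI triple_inject)

text \<open>In these inversions the index modulo 4, together with its size, determines the rule,
  which is how \<open>presburger\<close> discards the others. Only the two rules for primitive
  recursion share an index; they differ in the recursion argument.\<close>

lemma justified_encode_pair:
  "justified p S (5 + 4 * cpair c d) n v \<Longrightarrow>
    \<exists>a b. v = cpair a b \<and> triple c n a \<in> S \<and> triple d n b \<in> S"
  by (erule justified.cases; (presburger | simp))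

lemma justified_encode_comp:
  "justified p S (6 + 4 * cpair c d) n v \<Longrightarrow> \<exists>a. triple d n a \<in> S \<and> triple c a v \<in> S"
  by (erule justified.cases; (presburger | (simp, blast)))

lemma justified_encode_prec_zero:
  "justified p S (7 + 4 * cpair c d) (cpair x 0) v \<Longrightarrow> triple c x v \<in> S"
  by (erule justified.cases; (presburger | simp))

lemma justified_encode_prec_Suc:
  "justified p S (7 + 4 * cpair c d) (cpair x (Suc k)) v \<Longrightarrow>
    \<exists>r. triple (7 + 4 * cpair c d) (cpair x k) r \<in> S \<and> triple d (cpair x (cpair k r)) v \<in> S"
  by (erule justified.cases; (presburger | auto))

lemma justified_encode_mu:
  "justified p S (8 + 4 * c) n v \<Longrightarrow>
    triple c (cpair n v) 0 \<in> S \<and> (\<forall>m<v. \<exists>r. triple c (cpair n m) (Suc r) \<in> S)"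
  by (erule justified.cases; (presburger | simp))

lemma justified_encode_basic:
  "justified p S 0 n v \<Longrightarrow> v = 0"
  "justified p S 1 n v \<Longrightarrow> v = Suc n"
  "justified p S 2 n v \<Longrightarrow> v = cfst n"
  "justified p S 3 n v \<Longrightarrow> v = csnd n"
  "justified p S 4 n v \<Longrightarrow> v = p n"
  by (erule justified.cases; (presburger | simp))+

lemma certificate_sound:
  assumes S: "certificate p S"
  shows "triple (encode c) n v \<in> S \<Longrightarrow> run p c n = Some v"
proof (induction c arbitrary: n v)
  case (RPair c d)
  then have "justified p S (5 + 4 * cpair (encode c) (encode d)) n v"
    using S by (simp add: certificate_def)
  from justified_encode_pair[OF this] show ?case using RPair.IH by auto
next
  case (RComp c d)
  then have "justified p S (6 + 4 * cpair (encode c) (encode d)) n v"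
    using S by (simp add: certificate_def)
  from justified_encode_comp[OF this] show ?case using RComp.IH by auto
next
  case (RPrec c d)
  have "run p (RPrec c d) (cpair x k) = Some v" if "triple (encode (RPrec c d)) (cpair x k) v \<in> S" for x k v
    using that
  proof (induction k arbitrary: v)
    case 0
    then have "justified p S (7 + 4 * cpair (encode c) (encode d)) (cpair x 0) v"
      using S by (simp add: certificate_def)
    from justified_encode_prec_zero[OF this] show ?case using RPrec.IH by simp
  next
    case (Suc k)
    then have "justified p S (7 + 4 * cpair (encode c) (encode d)) (cpair x (Suc k)) v"
      using S by (simp add: certificate_def)
    from justified_encode_prec_Suc[OF this]
    obtain r where "triple (encode (RPrec c d)) (cpair x k) r \<in> S"
       "triple (encode d) (cpair x (cpair k r)) v \<in> S"
      by auto
    then show ?case using Suc.IH RPrec.IH by simp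
  qed
  then show ?case using RPrec.prems by (metis cpair_cfst_csnd)
next
  case (RMu c)
  then have "justified p S (8 + 4 * encode c) n v"
    using S by (simp add: certificate_def)
  then have 0: "run p c (cpair n v) = Some 0" and
    S: "\<forall>m<v. \<exists>r. run p c (cpair n m) = Some (Suc r)"
    using RMu.IH justified_encode_mu by blast+
  have "(LEAST m. run p c (cpair n m) = Some 0) = v"
  proof (rule Least_equality)
    show "v \<le> m" if "run p c (cpair n m) = Some 0" for m
      using that S by (metis Zero_not_Suc linorder_not_le option.inject)
  qed fact
  moreover have "\<exists>m. run p c (cpair n m) = Some 0 \<and> (\<forall>k<m. run p c (cpair n k) \<noteq> None)"
    using 0 S by (intro exI[of _ v]) auto
  ultimately show ?case by simp
next
  case RZero
  then show ?case using justified_encode_basic(1)[of p S n v] S by (simp add: certificate_def)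
next
  case RSucc
  then show ?case using justified_encode_basic(2)[of p S n v] S by (simp add: certificate_def)
next
  case RFst
  then show ?case using justified_encode_basic(3)[of p S n v] S by (simp add: certificate_def)
next
  case RSnd
  then show ?case using justified_encode_basic(4)[of p S n v] S by (simp add: certificate_def)
next
  case ROracle
  then show ?case using justified_encode_basic(5)[of p S n v] S by (simp add: certificate_def)
qed

text \<open>Finiteness is the point: a convergent computation rests on finitely many
  subcomputations, so its certificate fits into one number.\<close>

lemma certificate_complete:
  "run p c n = Some v \<Longrightarrow> \<exists>S. finite S \<and> certificate p S \<and> triple (encode c) n v \<in> S"
proof (induction c arbitrary: n v)
  case (RPair c d)
  then obtain a b where ab: "run p c n = Some a" "run p d n = Some b" "v = cpair a b"
    by (auto simp: bind_eq_Some_conv)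
  obtain S T where S: "finite S" "certificate p S" "triple (encode c) n a \<in> S"
    and T: "finite T" "certificate p T" "triple (encode d) n b \<in> T"
    using ab RPair.IH by meson
  have "certificate p (S \<union> T)" using certificate_Union[of "{S, T}"] S T by auto
  moreover have "justified p (S \<union> T) (encode (RPair c d)) n v"
    unfolding encode.simps ab(3) using S T by (intro justified.pair[of _ _ a]) auto
  ultimately show ?case using S(1) T(1) certificate_insert
    by (intro exI[of _ "insert (triple (encode (RPair c d)) n v) (S \<union> T)"]) blast
next
  case (RComp c d)
  then obtain a where ab: "run p d n = Some a" "run p c a = Some v"
    by (auto simp: bind_eq_Some_conv)
  obtain S T where S: "finite S" "certificate p S" "triple (encode d) n a \<in> S"
    and T: "finite T" "certificate p T" "triple (encode c) a v \<in> T"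
    using ab RComp.IH by meson
  have "certificate p (S \<union> T)" using certificate_Union[of "{S, T}"] S T by auto
  moreover have "justified p (S \<union> T) (encode (RComp c d)) n v"
    unfolding encode.simps using S T by (intro justified.comp[of _ _ a]) auto
  ultimately show ?case using S(1) T(1) certificate_insert
    by (intro exI[of _ "insert (triple (encode (RComp c d)) n v) (S \<union> T)"]) blast
next
  case (RPrec c d)
  have "\<exists>S. finite S \<and> certificate p S \<and> triple (encode (RPrec c d)) (cpair x k) v \<in> S"
    if "run p (RPrec c d) (cpair x k) = Some v" for x k v
    using that
  proof (induction k arbitrary: v)
    case 0
    then obtain S where S: "finite S" "certificate p S" "triple (encode c) x v \<in> S"
      using RPrec.IH(1)[of x v] by auto
    then have "justified p S (encode (RPrec c d)) (cpair x 0) v"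
      unfolding encode.simps by (intro justified.prec_zero)
    then show ?case using S certificate_insert by blast
  next
    case (Suc k)
    then obtain r where r: "run p (RPrec c d) (cpair x k) = Some r"
        "run p d (cpair x (cpair k r)) = Some v"
      by (auto simp: bind_eq_Some_conv)
    obtain S T where S: "finite S" "certificate p S" "triple (encode (RPrec c d)) (cpair x k) r \<in> S"
      and T: "finite T" "certificate p T" "triple (encode d) (cpair x (cpair k r)) v \<in> T"
      using r RPrec.IH(2) Suc.IH by meson
    have "certificate p (S \<union> T)" using certificate_Union[of "{S, T}"] S T by auto
    moreover have "justified p (S \<union> T) (encode (RPrec c d)) (cpair x (Suc k)) v"
      unfolding encode.simps using S T by (intro justified.prec_Suc[of _ _ _ _ r]) auto
    ultimately show ?case using S(1) T(1) certificate_insert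
      by (intro exI[of _ "insert (triple (encode (RPrec c d)) (cpair x (Suc k)) v) (S \<union> T)"]) blast
  qed
  then show ?case using RPrec.prems by (metis cpair_cfst_csnd)
next
  case (RMu c)
  then have ex: "\<exists>m. run p c (cpair n m) = Some 0 \<and> (\<forall>k<m. run p c (cpair n k) \<noteq> None)"
    and v: "v = (LEAST m. run p c (cpair n m) = Some 0)"
    by (auto split: if_splits)
  have 0: "run p c (cpair n v) = Some 0" unfolding v using ex by (metis (mono_tags) LeastI)
  have "\<exists>S. finite S \<and> certificate p S \<and> (\<exists>r. triple (encode c) (cpair n m) (Suc r) \<in> S)"
    if "m < v" for m
  proof -
    have "run p c (cpair n m) \<noteq> Some 0" using that not_less_Least unfolding v by blast
    moreover obtain m' where m': "run p c (cpair n m') = Some 0" "\<forall>k<m'. run p c (cpair n k) \<noteq> None"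
      using ex by blast
    then have "v \<le> m'" unfolding v by (intro Least_le)
    with m' that have "run p c (cpair n m) \<noteq> None" by auto
    ultimately obtain r where "run p c (cpair n m) = Some (Suc r)"
      by (metis not0_implies_Suc option.exhaust)
    from RMu.IH[OF this] show ?thesis by blast
  qed
  \<comment> \<open>One certificate is chosen for each of the \<open>v\<close> values before the
    least zero; their union remains finite.\<close>
  then have "\<forall>m\<in>{..<v}. \<exists>S. finite S \<and> certificate p S \<and>
      (\<exists>r. triple (encode c) (cpair n m) (Suc r) \<in> S)"
    by simp
  from bchoice[OF this] obtain F where F: "\<And>m. m < v \<Longrightarrow> finite (F m) \<and> certificate p (F m) \<and>
      (\<exists>r. triple (encode c) (cpair n m) (Suc r) \<in> F m)"
    by blast
  obtain S where S: "finite S" "certificate p S" "triple (encode c) (cpair n v) 0 \<in> S"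
    using RMu.IH[OF 0] by blast
  define T where "T = \<Union>(insert S (F ` {..<v}))"
  have T: "finite T" unfolding T_def using S F by auto
  have T': "certificate p T" unfolding T_def by (rule certificate_Union) (use S F in auto)
  have "justified p T (encode (RMu c)) n v"
    unfolding encode.simps
  proof (rule justified.mu)
    show "triple (encode c) (cpair n v) 0 \<in> T" using S(3) by (simp add: T_def)
    show "\<forall>m<v. \<exists>r. triple (encode c) (cpair n m) (Suc r) \<in> T"
    proof (intro allI impI)
      fix m assume "m < v"
      with F[OF this] show "\<exists>r. triple (encode c) (cpair n m) (Suc r) \<in> T"
        unfolding T_def by auto
    qed
  qed
  from certificate_insert[OF T' this] show ?case
    by (intro exI[of _ "insert (triple (encode (RMu c)) n v) T"]) (simp add: T)
next
  case RZero
  then show ?case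
    by (intro exI[of _ "{triple 0 n 0}"]) (auto simp: certificate_def intro: justified.intros)
next
  case RSucc
  then show ?case
    by (intro exI[of _ "{triple 1 n (Suc n)}"]) (auto simp: certificate_def intro: justified.intros)
next
  case RFst
  then show ?case
    by (intro exI[of _ "{triple 2 n (cfst n)}"]) (auto simp: certificate_def intro: justified.intros)
next
  case RSnd
  then show ?case
    by (intro exI[of _ "{triple 3 n (csnd n)}"]) (auto simp: certificate_def intro: justified.intros)
next
  case ROracle
  then show ?case
    by (intro exI[of _ "{triple 4 n (p n)}"]) (auto simp: certificate_def intro: justified.intros)
qed


text \<open>Every number codes a finite set through its binary digits, so \<open>s\<close> can be
  searched for. It plays the role of a step count but is not monotone: a larger number may fail to
  code a certificate.\<close>

definition computes_by :: "baire \<Rightarrow> nat \<Rightarrow> nat \<Rightarrow> nat \<Rightarrow> nat \<Rightarrow> bool" where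
  "computes_by p s i n v \<longleftrightarrow> certificate p (set_decode s) \<and> triple i n v \<in> set_decode s"

lemma phi_eq_Some_iff: "phi p i n = Some v \<longleftrightarrow> (\<exists>s. computes_by p s i n v)"
proof -
  obtain c where i: "i = encode c" using surj_encode by blast
  show ?thesis
  proof
    assume "phi p i n = Some v"
    then obtain S where "finite S" "certificate p S" "triple i n v \<in> S"
      using certificate_complete[of p c n v] i by auto
    then show "\<exists>s. computes_by p s i n v"
      by (intro exI[of _ "set_encode S"]) (simp add: computes_by_def)
  next
    assume "\<exists>s. computes_by p s i n v"
    then show "phi p i n = Some v"
      using certificate_sound i by (auto simp: computes_by_def)
  qed
qed

lemma set_decode_less: "z \<in> set_decode s \<Longrightarrow> z < s"
  by (metis div_less even_zero less_exp order.strict_trans1 linorder_not_le mem_Collect_eq set_decode_def)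

lemma le_triple: "i \<le> triple i n v" "n \<le> triple i n v" "v \<le> triple i n v"
  unfolding triple_def by (metis cfst_cpair csnd_cpair cfst_le csnd_le le_trans)+

lemma triple_set_decode_less:
  assumes "triple i n v \<in> set_decode s" shows "i < s" "n < s" "v < s"
  using set_decode_less[OF assms] le_triple le_less_trans by metis+

lemma justified_cong:
  assumes "justified p S i n v" "p n = q n"
  shows "justified q S i n v"
  using assms by (cases rule: justified.cases) (auto intro: justified.intros)

text \<open>The use principle: a certificate queries the oracle only at arguments of its triples,
  and these lie below the code \<open>s\<close>.\<close>

lemma computes_by_local:
  assumes "computes_by p s i n v" "\<And>j. j < s \<Longrightarrow> p j = q j"
  shows "computes_by q s i n v"
  using assms unfolding computes_by_def certificate_def
  by (meson justified_cong triple_set_decode_less(2))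

lemma le_cpair: "c \<le> cpair c d" "d \<le> cpair c d"
  by (metis cfst_cpair csnd_cpair cfst_le csnd_le)+

lemma cpair_less_index: "0 < k \<Longrightarrow> c < k + 4 * cpair c d \<and> d < k + 4 * cpair c d"
  using le_cpair(1)[of c d] le_cpair(2)[of d c] by linarith

text \<open>Programs are larger than their parts, and entries of a triple are smaller than the code
  of a set containing it. Hence every quantifier can be bounded by \<open>i\<close>,
  \<open>s\<close> or \<open>v\<close>, which makes the relation decidable in the oracle.\<close>

lemma justified_bounded:
  "justified p (set_decode s) i n v \<longleftrightarrow>
     i = 0 \<and> v = 0 \<or> i = 1 \<and> v = Suc n \<or> i = 2 \<and> v = cfst n \<or> i = 3 \<and> v = csnd n \<or>
     i = 4 \<and> v = p n \<or>
     (\<exists>c<i. \<exists>d<i. i = 5 + 4 * cpair c d \<and>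
        triple c n (cfst v) \<in> set_decode s \<and> triple d n (csnd v) \<in> set_decode s) \<or>
     (\<exists>c<i. \<exists>d<i. i = 6 + 4 * cpair c d \<and>
        (\<exists>a<s. triple d n a \<in> set_decode s \<and> triple c a v \<in> set_decode s)) \<or>
     (\<exists>c<i. \<exists>d<i. i = 7 + 4 * cpair c d \<and> csnd n = 0 \<and> triple c (cfst n) v \<in> set_decode s) \<or>
     (\<exists>c<i. \<exists>d<i. i = 7 + 4 * cpair c d \<and> csnd n \<noteq> 0 \<and>
        (\<exists>r<s. triple i (cpair (cfst n) (csnd n - 1)) r \<in> set_decode s \<and>
           triple d (cpair (cfst n) (cpair (csnd n - 1) r)) v \<in> set_decode s)) \<or>
     (\<exists>c<i. i = 8 + 4 * c \<and> triple c (cpair n v) 0 \<in> set_decode s \<and>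
        (\<forall>m<v. \<exists>r<s. triple c (cpair n m) (Suc r) \<in> set_decode s))"
  (is "?L \<longleftrightarrow> ?R")
proof
  show "?L \<Longrightarrow> ?R"
  proof (induction rule: justified.induct)
    case (pair c n a d b)
    then have "\<exists>c'<5 + 4 * cpair c d. \<exists>d'<5 + 4 * cpair c d. 5 + 4 * cpair c d = 5 + 4 * cpair c' d' \<and>
        triple c' n (cfst (cpair a b)) \<in> set_decode s \<and> triple d' n (csnd (cpair a b)) \<in> set_decode s"
      using cpair_less_index[of 5 c d]
      by (intro exI[of _ c] exI[of _ d] conjI) simp_all
    then show ?case by blast
  next
    case (comp d n a c v)
    then have "\<exists>c'<6 + 4 * cpair c d. \<exists>d'<6 + 4 * cpair c d. 6 + 4 * cpair c d = 6 + 4 * cpair c' d' \<and>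
        (\<exists>a<s. triple d' n a \<in> set_decode s \<and> triple c' a v \<in> set_decode s)"
      using cpair_less_index[of 6 c d] triple_set_decode_less(3)[OF comp(1)]
      by (intro exI[of _ c] exI[of _ d] exI[of _ a] conjI) simp_all
    then show ?case by blast
  next
    case (prec_zero c x v d)
    then have "\<exists>c'<7 + 4 * cpair c d. \<exists>d'<7 + 4 * cpair c d. 7 + 4 * cpair c d = 7 + 4 * cpair c' d' \<and>
        csnd (cpair x 0) = 0 \<and> triple c' (cfst (cpair x 0)) v \<in> set_decode s"
      using cpair_less_index[of 7 c d]
      by (intro exI[of _ c] exI[of _ d] conjI) simp_all
    then show ?case by blast
  next
    case (prec_Suc c d x k r v)
    then have "\<exists>c'<7 + 4 * cpair c d. \<exists>d'<7 + 4 * cpair c d. 7 + 4 * cpair c d = 7 + 4 * cpair c' d' \<and>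
        csnd (cpair x (Suc k)) \<noteq> 0 \<and>
        (\<exists>r<s. triple (7 + 4 * cpair c d)
             (cpair (cfst (cpair x (Suc k))) (csnd (cpair x (Suc k)) - 1)) r \<in> set_decode s \<and>
           triple d' (cpair (cfst (cpair x (Suc k))) (cpair (csnd (cpair x (Suc k)) - 1) r)) v
             \<in> set_decode s)"
      using cpair_less_index[of 7 c d] triple_set_decode_less(3)[OF prec_Suc(1)]
      by (intro exI[of _ c] exI[of _ d] exI[of _ r] conjI) simp_all
    then show ?case by blast
  next
    case (mu c n v)
    then have "\<forall>m<v. \<exists>r<s. triple c (cpair n m) (Suc r) \<in> set_decode s"
      by (meson Suc_lessD triple_set_decode_less(3))
    then have "\<exists>c'<8 + 4 * c. 8 + 4 * c = 8 + 4 * c' \<and> triple c' (cpair n v) 0 \<in> set_decode s \<and>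
        (\<forall>m<v. \<exists>r<s. triple c' (cpair n m) (Suc r) \<in> set_decode s)"
      using mu(1) by (intro exI[of _ c] conjI) simp_all
    then show ?case by blast
  qed simp_all
next
  assume ?R
  then show ?L
  proof (elim disjE exE conjE)
    fix c d
    assume i: "i = 5 + 4 * cpair c d" and
      *: "triple c n (cfst v) \<in> set_decode s" "triple d n (csnd v) \<in> set_decode s"
    show ?L unfolding i using justified.pair[OF *] by simp
  next
    fix c d a
    assume i: "i = 6 + 4 * cpair c d" and
      *: "triple d n a \<in> set_decode s" "triple c a v \<in> set_decode s"
    show ?L unfolding i using justified.comp[OF *] by simp
  next
    fix c d
    assume i: "i = 7 + 4 * cpair c d" and *: "csnd n = 0" "triple c (cfst n) v \<in> set_decode s"
    show ?L unfolding i using justified.prec_zero[OF *(2)] *(1) by (metis cpair_cfst_csnd)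
  next
    fix c d r
    assume i: "i = 7 + 4 * cpair c d" and *: "csnd n \<noteq> 0"
        "triple i (cpair (cfst n) (csnd n - 1)) r \<in> set_decode s"
        "triple d (cpair (cfst n) (cpair (csnd n - 1) r)) v \<in> set_decode s"
    have "Suc (csnd n - 1) = csnd n" using * by simp
    then show ?L unfolding i using justified.prec_Suc[OF *(2)[unfolded i] *(3)] by simp
  next
    fix c
    assume i: "i = 8 + 4 * c" and *: "triple c (cpair n v) 0 \<in> set_decode s"
        "\<forall>m<v. \<exists>r<s. triple c (cpair n m) (Suc r) \<in> set_decode s"
    show ?L unfolding i using * by (intro justified.mu) blast+
  qed (use justified.intros in simp)+
qed

lemma computable_pred_set_decode [computable_intros]:
  assumes "computable_fun f" "computable_fun g"
  shows "computable_pred (\<lambda>p n. f p n \<in> set_decode (g p n))"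
proof -
  have "s div 2 ^ z = rec_nat s (\<lambda>k r. r div 2) z" for s z :: nat
    by (induction z) (simp_all add: mult.commute[of 2] div_mult2_eq)
  then have "z \<in> set_decode s \<longleftrightarrow> \<not> even (rec_nat s (\<lambda>k r. r div 2) z)" for s z
    by (simp add: set_decode_def)
  moreover have "computable_pred (\<lambda>p n. \<not> even (rec_nat (g p n) (\<lambda>k r. r div 2) (f p n)))"
    by (intro computable_intros assms)
  ultimately show ?thesis by simp
qed

lemma computable_fun_triple [computable_intros]:
  "computable_fun f \<Longrightarrow> computable_fun g \<Longrightarrow> computable_fun h \<Longrightarrow>
    computable_fun (\<lambda>p n. triple (f p n) (g p n) (h p n))"
  unfolding triple_def by (intro computable_intros)

lemma computable_pred_justified:
  "computable_pred (\<lambda>p z. justified p (set_decode (cfst z)) (cfst (csnd z))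
     (cfst (csnd (csnd z))) (csnd (csnd (csnd z))))"
  unfolding justified_bounded by (intro computable_intros)

lemma certificate_set_decode:
  "certificate p (set_decode s) \<longleftrightarrow>
    (\<forall>z<s. z \<in> set_decode s \<longrightarrow> justified p (set_decode s) (cfst z) (cfst (csnd z)) (csnd (csnd z)))"
  unfolding certificate_def triple_def
  by (metis cfst_cpair csnd_cpair cpair_cfst_csnd set_decode_less)

lemma computable_pred_computes_by [computable_intros]:
  assumes "computable_fun s" "computable_fun i" "computable_fun n" "computable_fun v"
  shows "computable_pred (\<lambda>p z. computes_by p (s p z) (i p z) (n p z) (v p z))"
proof -
  have "computable_pred (\<lambda>p z. justified p (set_decode (cfst z)) (cfst (csnd z))
     (cfst (csnd (csnd z))) (csnd (csnd (csnd z))))"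
    by (rule computable_pred_justified)
  then have [computable_intros]: "computable_pred (\<lambda>p z. justified p (set_decode (s p (cfst z)))
      (cfst (csnd z)) (cfst (csnd (csnd z))) (csnd (csnd (csnd z))))"
    using computable_pred_comp[of _ "\<lambda>p z. cpair (s p (cfst z)) (csnd z)"]
      computable_fun_cpair[OF computable_fun_comp[OF assms(1) computable_fun_cfst[OF computable_fun_id]]
        computable_fun_csnd[OF computable_fun_id]]
    by fastforce
  show ?thesis
    unfolding computes_by_def certificate_set_decode
    by (intro computable_intros assms computable_fun_comp[OF assms(1)])
qed

section \<open>Universality and unbounded search\<close>

text \<open>Universality. The search runs over pairs \<open>w\<close> of a value and a certificate
  for it; by soundness the least hit carries the right value.\<close>

lemma computable_pfun_phi:
  assumes "computable_fun i" "computable_fun m"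
  shows "computable_pfun (\<lambda>p n. phi p (i p n) (m p n))"
proof -
  let ?P = "\<lambda>p n w. computes_by p (csnd w) (i p n) (m p n) (cfst w)"
  have "computable_pfun (\<lambda>p n. Option.bind
      (if \<exists>w. ?P p n w then Some (LEAST w. ?P p n w) else None) (\<lambda>w. Some (cfst w)))"
    by (intro computable_pfun_bind computable_pfun_Least computable_intros
        computable_fun_comp[OF assms(1)] computable_fun_comp[OF assms(2)])
  moreover have "Option.bind (if \<exists>w. ?P p n w then Some (LEAST w. ?P p n w) else None)
      (\<lambda>w. Some (cfst w)) = phi p (i p n) (m p n)" for p n
  proof (cases "phi p (i p n) (m p n)")
    case None
    then have "\<not> (\<exists>w. ?P p n w)" using phi_eq_Some_iff by (metis option.distinct(1))
    then show ?thesis using None by simp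
  next
    case (Some v)
    then obtain s where "computes_by p s (i p n) (m p n) v" using phi_eq_Some_iff by blast
    then have ex: "?P p n (cpair v s)" by simp
    then have "?P p n (LEAST w. ?P p n w)" by (rule LeastI)
    then have "phi p (i p n) (m p n) = Some (cfst (LEAST w. ?P p n w))"
      using phi_eq_Some_iff by blast
    moreover have "\<exists>w. ?P p n w" using ex by blast
    ultimately show ?thesis by simp
  qed
  ultimately show ?thesis by simp
qed

text \<open>Dovetailing: \<open>w\<close> packs a candidate \<open>a\<close>, a value and a
  certificate, so a candidate with a divergent computation does not block the others. Which
  candidate is found depends on the coding, hence the specification only promises convergence
  there.\<close>

lemma computable_pfun_search:
  assumes "computable_pfun (\<lambda>p z. f p (cfst z) (csnd z))"
  shows "\<exists>h. computable_pfun h \<and> (\<forall>p n. h p n = None \<longleftrightarrow> (\<forall>a. f p n a = None)) \<and>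
    (\<forall>p n a. h p n = Some a \<longrightarrow> f p n a \<noteq> None)"
proof -
  obtain c where c: "\<And>p z. run p c z = f p (cfst z) (csnd z)"
    using assms unfolding computable_pfun_def by blast
  let ?P = "\<lambda>p n w. computes_by p (csnd (csnd w)) (encode c) (cpair n (cfst w)) (cfst (csnd w))"
  have f: "f p n a = Some v \<longleftrightarrow> (\<exists>s. ?P p n (cpair a (cpair v s)))" for p n a v
    using c[of p "cpair n a"] phi_eq_Some_iff[of p "encode c" "cpair n a" v] by simp
  let ?h = "\<lambda>p n. Option.bind
      (if \<exists>w. ?P p n w then Some (LEAST w. ?P p n w) else None) (\<lambda>w. Some (cfst w))"
  show ?thesis
  proof (intro exI[of _ ?h] conjI allI impI)
    show "computable_pfun ?h"
      by (intro computable_pfun_bind computable_pfun_Least computable_intros)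
    show "f p n a \<noteq> None" if "?h p n = Some a" for p n a
    proof -
      have "\<exists>w. ?P p n w" and a: "a = cfst (LEAST w. ?P p n w)"
        using that by (auto simp: bind_eq_Some_conv split: if_splits)
      then have "?P p n (LEAST w. ?P p n w)" by (metis (no_types, lifting) LeastI)
      then have "f p n a = Some (cfst (csnd (LEAST w. ?P p n w)))"
        unfolding f a by (intro exI[of _ "csnd (csnd (LEAST w. ?P p n w))"]) simp
      then show ?thesis by simp
    qed
    show "?h p n = None \<longleftrightarrow> (\<forall>a. f p n a = None)" for p n
    proof -
      have "(\<exists>w. ?P p n w) \<longleftrightarrow> (\<exists>a v. f p n a = Some v)"
        unfolding f by (metis cfst_cpair csnd_cpair)
      then show ?thesis by auto
    qed
  qed
qed

lemma computable_pfun_parallel: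
  assumes "computable_pfun f" "computable_pfun g"
  shows "\<exists>h. computable_pfun h \<and> (\<forall>p n. h p n = None \<longleftrightarrow> f p n = None \<and> g p n = None) \<and>
    (\<forall>p n v. h p n = Some v \<longrightarrow> f p n = Some v \<or> g p n = Some v)"
proof -
  obtain c d where c: "\<And>p z. run p c z = f p z" and d: "\<And>p z. run p d z = g p z"
    using assms unfolding computable_pfun_def by blast
  \<comment> \<open>An index is selected before anything is run, so divergence of one program leaves
    the other untouched, and the race becomes a search for \<open>a\<close>.\<close>
  define F where "F = (\<lambda>p n (a::nat). phi p (if a = 0 then encode c else encode d) n)"
  have F: "F p n a = (if a = 0 then f p n else g p n)" for p n a
    by (simp add: F_def c d)
  have comp: "computable_pfun (\<lambda>p z. F p (cfst z) (csnd z))"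
    unfolding F_def by (intro computable_pfun_phi computable_intros)
  then obtain h where h: "computable_pfun h" "\<And>p n. h p n = None \<longleftrightarrow> (\<forall>a. F p n a = None)"
    "\<And>p n a. h p n = Some a \<Longrightarrow> F p n a \<noteq> None"
    using computable_pfun_search[of F] by blast
  show ?thesis
  proof (intro exI[of _ "\<lambda>p n. Option.bind (h p n) (F p n)"] conjI allI impI)
    show "computable_pfun (\<lambda>p n. Option.bind (h p n) (F p n))"
      by (intro computable_pfun_bind h comp)
    show "Option.bind (h p n) (F p n) = None \<longleftrightarrow> f p n = None \<and> g p n = None" for p n
    proof (cases "h p n")
      case None
      then have "\<forall>a. F p n a = None" using h(2) by blast
      then show ?thesis using None F[of p n 0] F[of p n 1] by simp
    next
      case (Some a)
      then show ?thesis using h(3)[OF Some] F[of p n a] by (auto split: if_splits)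
    qed
    show "f p n = Some v \<or> g p n = Some v" if "Option.bind (h p n) (F p n) = Some v" for p n v
      using that by (auto simp: bind_eq_Some_conv F split: if_splits)
  qed
qed

section \<open>Operators whose arguments are points of Baire space\<close>

lemma computable_fun_app:
  assumes "computable_fun (\<lambda>p z. f p (cfst z) (csnd z))" "computable_fun m"
  shows "computable_fun (\<lambda>p n. f p n (m p n))"
  using computable_fun_comp[OF assms(1) computable_fun_cpair[OF computable_fun_id assms(2)]] by simp

lemma computable_fun_ntl [computable_intros]:
  "computable_fun (\<lambda>p z. f p (cfst z) (csnd z)) \<Longrightarrow> computable_fun m \<Longrightarrow>
    computable_fun (\<lambda>p n. ntl (f p n) (m p n))"
  unfolding ntl_def by (rule computable_fun_app[of f]) (assumption | intro computable_intros)+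

lemma computable_fun_ncons [computable_intros]:
  assumes "computable_fun i" "computable_fun (\<lambda>p z. f p (cfst z) (csnd z))" "computable_fun m"
  shows "computable_fun (\<lambda>p n. ncons (i p n) (f p n) (m p n))"
proof -
  have "ncons a q k = (if k = 0 then a else q (k - 1))" for a q k
    by (simp add: ncons_def split: nat.split)
  then show ?thesis
    by (simp only:) (intro computable_intros computable_fun_app[of f] assms)
qed

lemma computable_fun_evens [computable_intros]:
  "computable_fun (\<lambda>p z. f p (cfst z) (csnd z)) \<Longrightarrow> computable_fun m \<Longrightarrow>
    computable_fun (\<lambda>p n. evens (f p n) (m p n))"
  unfolding evens_def by (rule computable_fun_app[of f]) (assumption | intro computable_intros)+

lemma computable_fun_odds [computable_intros]:
  "computable_fun (\<lambda>p z. f p (cfst z) (csnd z)) \<Longrightarrow> computable_fun m \<Longrightarrow>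
    computable_fun (\<lambda>p n. odds (f p n) (m p n))"
  unfolding odds_def by (rule computable_fun_app[of f]) (assumption | intro computable_intros)+

lemma computable_fun_join [computable_intros]:
  assumes "computable_fun (\<lambda>p z. f p (cfst z) (csnd z))"
    "computable_fun (\<lambda>p z. g p (cfst z) (csnd z))" "computable_fun m"
  shows "computable_fun (\<lambda>p n. join (f p n) (g p n) (m p n))"
  unfolding join_def
  by (intro computable_intros computable_fun_app[of f] computable_fun_app[of g] assms)

lemma computable_fun_seq_proj [computable_intros]:
  assumes "computable_fun (\<lambda>p z. f p (cfst z) (csnd z))" "computable_fun i" "computable_fun m"
  shows "computable_fun (\<lambda>p n. seq_proj (f p n) (i p n) (m p n))"
  unfolding seq_proj_def by (rule computable_fun_app[of f]) (intro computable_intros assms)+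

lemma computable_pred_computes_by_oracle:
  assumes "computable_fun (\<lambda>p z. Q p (cfst z) (csnd z))"
    "computable_fun s" "computable_fun i" "computable_fun n" "computable_fun v"
  shows "computable_pred (\<lambda>p z. computes_by (Q p z) (s p z) (i p z) (n p z) (v p z))"
proof -
  have "computable_pred (\<lambda>q w. computes_by q (cfst w) (cfst (csnd w)) (cfst (csnd (csnd w)))
      (csnd (csnd (csnd w))))"
    by (intro computable_intros)
  from computable_pred_oracle_change[OF this assms(1) computable_fun_cpair[OF assms(2)
      computable_fun_cpair[OF assms(3) computable_fun_cpair[OF assms(4,5)]]]]
  show ?thesis by simp
qed

lemma computable_pfun_phi_oracle:
  assumes "computable_fun (\<lambda>p z. Q p (cfst z) (csnd z))" "computable_fun i" "computable_fun m"
  shows "computable_pfun (\<lambda>p n. phi (Q p n) (i p n) (m p n))"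
proof -
  have "computable_pfun (\<lambda>q w. phi q (cfst w) (csnd w))"
    by (intro computable_intros computable_pfun_phi)
  from computable_pfun_oracle[OF this assms(1) computable_fun_cpair[OF assms(2,3)]]
  show ?thesis by simp
qed

text \<open>A search for a number \<open>m\<close> that does not occur in the condition stops at 0
  if \<open>P\<close> holds and never stops otherwise.\<close>

lemma computable_pfun_guard:
  assumes "computable_pred P" "computable_pfun f"
  shows "computable_pfun (\<lambda>p n. if P p n then f p n else None)"
proof -
  have "computable_pfun (\<lambda>p n. Option.bind
      (if \<exists>m::nat. P p n then Some (LEAST m::nat. P p n) else None) (\<lambda>m. f p n))"
    by (intro computable_pfun_bind computable_pfun_Least
        computable_pred_comp[OF assms(1)] computable_pfun_comp[OF assms(2)] computable_intros)
  moreover have "Option.bind (if \<exists>m::nat. P p n then Some (LEAST m::nat. P p n) else None) (\<lambda>m. f p n) =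
      (if P p n then f p n else None)" for p n
    by simp
  ultimately show ?thesis by simp
qed

section \<open>Computable operators and Turing reducibility\<close>

lemma turing_le_iff: "q \<le>\<^sub>T p \<longleftrightarrow> (\<exists>c. \<forall>n. run p c n = Some (q n))"
  unfolding turing_le_def by (metis phi_def phi_encode)

lemma computable_iff: "computable F \<longleftrightarrow> (\<exists>c. \<forall>p q. F p = Some q \<longrightarrow> (\<forall>n. run p c n = Some (q n)))"
proof
  assume "computable F"
  then show "\<exists>c. \<forall>p q. F p = Some q \<longrightarrow> (\<forall>n. run p c n = Some (q n))"
    unfolding computable_def phi_def by blast
next
  assume "\<exists>c. \<forall>p q. F p = Some q \<longrightarrow> (\<forall>n. run p c n = Some (q n))"
  then obtain c where "\<forall>p q. F p = Some q \<longrightarrow> (\<forall>n. run p c n = Some (q n))" by blast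
  then show "computable F"
    unfolding computable_def by (intro exI[of _ "encode c"]) simp
qed

lemma computable_fun_turing_le: "computable_fun f \<Longrightarrow> f p \<le>\<^sub>T p"
  unfolding turing_le_iff computable_fun_def computable_pfun_def by metis

lemma computable_Some:
  assumes "computable_fun f" shows "computable (\<lambda>p. Some (f p))"
proof -
  obtain c where "\<And>p n. run p c n = Some (f p n)"
    using assms unfolding computable_fun_def computable_pfun_def by blast
  then show ?thesis unfolding computable_iff by (intro exI[of _ c]) simp
qed

lemma computable_total:
  assumes "computable F" "\<And>p. F p = Some (f p)" shows "computable_fun f"
proof -
  obtain c where "\<And>p q n. F p = Some q \<Longrightarrow> run p c n = Some (q n)"
    using assms(1) unfolding computable_iff by blast
  with assms(2) show ?thesis by (intro computable_funI[of c]) simp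
qed

text \<open>Substitution with the parameter fixed to 0. It works for a program \<open>d\<close> that
  is total relative to one particular oracle, whereas \<open>computable_pfun_oracle\<close> asks for
  totality relative to all oracles.\<close>

definition change_oracle :: "code \<Rightarrow> code \<Rightarrow> code" where
  "change_oracle d c = RComp (subst_oracle (RComp d RSnd) c) (RPair RZero (RPair RFst RSnd))"

lemma run_change_oracle:
  assumes "\<And>j. run p d j = Some (q j)"
  shows "run p (change_oracle d c) n = run q c n"
  using run_subst_oracle[of p "RComp d RSnd" 0 q c n] assms by (simp add: change_oracle_def)

lemma turing_trans:
  assumes "r \<le>\<^sub>T q" "q \<le>\<^sub>T p" shows "r \<le>\<^sub>T p"
proof -
  obtain c where c: "\<And>n. run q c n = Some (r n)" using assms(1) unfolding turing_le_iff by blast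
  obtain d where d: "\<And>n. run p d n = Some (q n)" using assms(2) unfolding turing_le_iff by blast
  show ?thesis unfolding turing_le_iff
    by (rule exI[of _ "change_oracle d c"]) (simp add: run_change_oracle[OF d] c)
qed

lemma computable_bind:
  assumes "computable F" "computable G" shows "computable (\<lambda>p. Option.bind (F p) G)"
proof -
  obtain d where d: "\<And>p q n. F p = Some q \<Longrightarrow> run p d n = Some (q n)"
    using assms(1) unfolding computable_iff by blast
  obtain c where c: "\<And>p q n. G p = Some q \<Longrightarrow> run p c n = Some (q n)"
    using assms(2) unfolding computable_iff by blast
  have "run p (change_oracle d c) n = Some (r n)" if "Option.bind (F p) G = Some r" for p r n
  proof -
    obtain q where "F p = Some q" "G q = Some r"
      using \<open>Option.bind _ _ = _\<close> by (auto simp: bind_eq_Some_conv)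
    then show ?thesis using run_change_oracle[of p d q] d c by simp
  qed
  then show ?thesis unfolding computable_iff by blast
qed

lemma computable_join:
  assumes "computable F" "computable G"
  shows "computable (\<lambda>p. Option.bind (F p) (\<lambda>q. Option.bind (G p) (\<lambda>r. Some (join q r))))"
proof -
  obtain c where c: "\<And>p q n. F p = Some q \<Longrightarrow> run p c n = Some (q n)"
    using assms(1) unfolding computable_iff by blast
  obtain d where d: "\<And>p q n. G p = Some q \<Longrightarrow> run p d n = Some (q n)"
    using assms(2) unfolding computable_iff by blast
  \<comment> \<open>Both programs may diverge outside their domains, so the index is selected by
    parity and then run universally.\<close>
  have "computable_pfun (\<lambda>p n. phi p (if even n then encode c else encode d) (n div 2))"
    by (intro computable_pfun_phi computable_intros)
  then obtain e where e: "\<And>p n. run p e n = (if even n then run p c (n div 2) else run p d (n div 2))"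
    unfolding computable_pfun_def by (metis phi_encode)
  have "run p e n = Some (s n)"
    if "Option.bind (F p) (\<lambda>q. Option.bind (G p) (\<lambda>r. Some (join q r))) = Some s" for p s n
    using that c d by (auto simp: bind_eq_Some_conv e join_def)
  then show ?thesis unfolding computable_iff by blast
qed

section \<open>Weihrauch reducibility\<close>

lemma weihrauch_leI:
  assumes "computable_fun k" "computable_fun h"
    and "\<And>p x. in_rep f p = Some x \<Longrightarrow> x \<in> pdom f \<Longrightarrow>
      \<exists>x'. in_rep g (k p) = Some x' \<and> x' \<in> pdom g \<and>
        (\<forall>q y. out_rep g q = Some y \<longrightarrow> y \<in> sol g x' \<longrightarrow>
          (\<exists>z. out_rep f (h (join p q)) = Some z \<and> z \<in> sol f x))"
  shows "f \<le>\<^sub>W g"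
  unfolding weihrauch_le_def
proof (intro exI conjI allI impI)
  show "computable (\<lambda>p. Some (h p))" "computable (\<lambda>p. Some (k p))"
    using assms computable_Some by blast+
  fix G assume G: "realizer G g"
  show "realizer (\<lambda>p. Option.bind (Some (k p)) (\<lambda>k. Option.bind (G k) (\<lambda>q. Some (h (join p q))))) f"
    unfolding realizer_def
  proof (intro allI impI, elim conjE)
    fix p x assume "in_rep f p = Some x" "x \<in> pdom f"
    from assms(3)[OF this] obtain x' where x': "in_rep g (k p) = Some x'" "x' \<in> pdom g"
      and sol: "\<forall>q y. out_rep g q = Some y \<longrightarrow> y \<in> sol g x' \<longrightarrow>
          (\<exists>z. out_rep f (h (join p q)) = Some z \<and> z \<in> sol f x)"
      by blast
    obtain q y where q: "G (k p) = Some q" "out_rep g q = Some y" "y \<in> sol g x'"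
      using G x' unfolding realizer_def by blast
    then show "\<exists>q y. Option.bind (Some (k p)) (\<lambda>k. Option.bind (G k) (\<lambda>q. Some (h (join p q)))) = Some q \<and>
        out_rep f q = Some y \<and> y \<in> sol f x"
      using sol by auto
  qed
qed

lemma strong_weihrauch_leI:
  assumes "computable_fun k" "computable_fun h"
    and "\<And>p x. in_rep f p = Some x \<Longrightarrow> x \<in> pdom f \<Longrightarrow>
      \<exists>x'. in_rep g (k p) = Some x' \<and> x' \<in> pdom g \<and>
        (\<forall>q y. out_rep g q = Some y \<longrightarrow> y \<in> sol g x' \<longrightarrow>
          (\<exists>z. out_rep f (h q) = Some z \<and> z \<in> sol f x))"
  shows "f \<le>\<^sub>s\<^sub>W g"
  unfolding strong_weihrauch_le_def
proof (intro exI conjI allI impI)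
  show "computable (\<lambda>p. Some (h p))" "computable (\<lambda>p. Some (k p))"
    using assms computable_Some by blast+
  fix G assume G: "realizer G g"
  show "realizer (\<lambda>p. Option.bind (Some (k p)) (\<lambda>k. Option.bind (G k) (\<lambda>q. Some (h q)))) f"
    unfolding realizer_def
  proof (intro allI impI, elim conjE)
    fix p x assume "in_rep f p = Some x" "x \<in> pdom f"
    from assms(3)[OF this] obtain x' where x': "in_rep g (k p) = Some x'" "x' \<in> pdom g"
      and sol: "\<forall>q y. out_rep g q = Some y \<longrightarrow> y \<in> sol g x' \<longrightarrow>
          (\<exists>z. out_rep f (h q) = Some z \<and> z \<in> sol f x)"
      by blast
    obtain q y where q: "G (k p) = Some q" "out_rep g q = Some y" "y \<in> sol g x'"
      using G x' unfolding realizer_def by blast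
    then show "\<exists>q y. Option.bind (Some (k p)) (\<lambda>k. Option.bind (G k) (\<lambda>q. Some (h q))) = Some q \<and>
        out_rep f q = Some y \<and> y \<in> sol f x"
      using sol by auto
  qed
qed

text \<open>The form in which a reduction is refuted. A realizer can be redefined at the single name
  \<open>k p\<close> to return any prescribed solution, so the reduction has to succeed for each
  solution \<open>q\<close> separately.\<close>

lemma weihrauch_le_baireD:
  assumes "f \<le>\<^sub>W g" "is_problem g" "in_rep g = baire_rep" "out_rep g = baire_rep"
    "in_rep f = baire_rep" "pdom f = UNIV"
  shows "\<exists>k c. computable_fun k \<and> (\<forall>p q. q \<in> sol g (k p) \<longrightarrow>
    (\<exists>r. (\<forall>n. run (join p q) c n = Some (r n)) \<and> (\<exists>z. out_rep f r = Some z \<and> z \<in> sol f p)))"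
proof -
  obtain H K where H: "computable H" and K: "computable K" and
    HK: "\<And>G. realizer G g \<Longrightarrow>
      realizer (\<lambda>p. Option.bind (K p) (\<lambda>k. Option.bind (G k) (\<lambda>q. H (join p q)))) f"
    using assms(1) unfolding weihrauch_le_def by blast
  obtain c where c: "\<And>p q n. H p = Some q \<Longrightarrow> run p c n = Some (q n)"
    using H unfolding computable_iff by blast
  obtain G where G: "realizer G g" using assms(2) unfolding is_problem_def by blast
  have real: "\<exists>r z. Option.bind (K p) (\<lambda>k. Option.bind (G' k) (\<lambda>q. H (join p q))) = Some r \<and>
      out_rep f r = Some z \<and> z \<in> sol f p" if "realizer G' g" for G' p
    using HK[OF that] assms(5,6) unfolding realizer_def by (simp add: baire_rep_def)
  \<comment> \<open>Every point is a name of an instance of \<open>f\<close>, and some realizer of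
    \<open>g\<close> exists; the composition is therefore defined everywhere.\<close>
  have "\<exists>k. K p = Some k" for p
    using real[OF G, of p] by (auto simp: bind_eq_Some_conv)
  then obtain k where k: "\<And>p. K p = Some (k p)" by metis
  have "\<exists>r. (\<forall>n. run (join p q) c n = Some (r n)) \<and> (\<exists>z. out_rep f r = Some z \<and> z \<in> sol f p)"
    if "q \<in> sol g (k p)" for p q
  proof -
    have "realizer (G(k p := Some q)) g"
      using G that assms(3,4) unfolding realizer_def by (auto simp: baire_rep_def)
    from real[OF this, of p] obtain r z where "H (join p q) = Some r" "out_rep f r = Some z" "z \<in> sol f p"
      by (auto simp: k)
    then show ?thesis using c by blast
  qed
  then show ?thesis using computable_total[OF K k] by blast
qed

lemma weihrauch_trans:
  assumes "f \<le>\<^sub>W g" "g \<le>\<^sub>W h" shows "f \<le>\<^sub>W h"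
proof -
  obtain H K where H: "computable H" and K: "computable K" and
    HK: "\<And>G. realizer G g \<Longrightarrow>
      realizer (\<lambda>p. Option.bind (K p) (\<lambda>k. Option.bind (G k) (\<lambda>q. H (join p q)))) f"
    using assms(1) unfolding weihrauch_le_def by blast
  obtain H' K' where H': "computable H'" and K': "computable K'" and
    HK': "\<And>G. realizer G h \<Longrightarrow>
      realizer (\<lambda>p. Option.bind (K' p) (\<lambda>k. Option.bind (G k) (\<lambda>q. H' (join p q)))) g"
    using assms(2) unfolding weihrauch_le_def by blast
  have ev: "computable (\<lambda>z. Some (evens z))" and od: "computable (\<lambda>z. Some (odds z))"
    by (intro computable_Some computable_intros)+
  \<comment> \<open>For \<open>z = join p q\<close>, \<open>A z\<close> is
    \<open>join (K p) q\<close> and \<open>B z\<close> pairs \<open>p\<close> with the resulting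
    answer for \<open>g\<close>: the intermediate instance has to be computed again from
    \<open>p\<close>.\<close>
  define A where "A z = Option.bind (Option.bind (Some (evens z)) K)
    (\<lambda>q. Option.bind (Some (odds z)) (\<lambda>r. Some (join q r)))" for z
  have A: "computable A" unfolding A_def by (intro computable_join computable_bind ev od K)
  define B where "B z = Option.bind (Some (evens z))
    (\<lambda>q. Option.bind (Option.bind (A z) H') (\<lambda>r. Some (join q r)))" for z
  have B: "computable B" unfolding B_def by (intro computable_join computable_bind ev A H')
  have "computable (\<lambda>z. Option.bind (B z) H)" by (intro computable_bind B H)
  moreover have "computable (\<lambda>p. Option.bind (K p) K')" by (intro computable_bind K K')
  moreover have "realizer (\<lambda>p. Option.bind (Option.bind (K p) K')
      (\<lambda>k. Option.bind (G k) (\<lambda>q. Option.bind (B (join p q)) H))) f" if "realizer G h" for G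
  proof -
    have "Option.bind (Option.bind (K p) K') (\<lambda>k. Option.bind (G k) (\<lambda>q. Option.bind (B (join p q)) H)) =
      Option.bind (K p) (\<lambda>k. Option.bind
        (Option.bind (K' k) (\<lambda>k'. Option.bind (G k') (\<lambda>q. H' (join k q)))) (\<lambda>q. H (join p q)))" for p
    proof (cases "K p")
      case (Some k)
      show ?thesis
      proof (cases "K' k")
        case (Some k')
        show ?thesis using \<open>K p = Some k\<close> Some
          by (cases "G k'") (auto simp: A_def B_def split: Option.bind_split)
      qed (simp add: Some)
    qed simp
    then show ?thesis using HK[OF HK'[OF that]] by simp
  qed
  ultimately show ?thesis unfolding weihrauch_le_def by blast
qed

section \<open>Stashing and the discontinuity problem\<close>

text \<open>Zeros are padding and the remaining entries agree, so it does not matter at which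
  positions they occur.\<close>

lemma minus_one_const:
  assumes "infinite {j. p j \<noteq> 0}" "\<And>j. p j \<noteq> 0 \<Longrightarrow> p j = Suc v"
  shows "minus_one p = Some (\<lambda>_. v)"
proof -
  have "p (enumerate {j. p j \<noteq> 0} k) = Suc v" for k
    using enumerate_in_set[OF assms(1), of k] assms(2) by blast
  then show ?thesis using assms(1) by (simp add: minus_one_def)
qed

text \<open>The instance of \<open>DIS\<close> is the function that maps \<open>m\<close> to some \<open>a\<close> for which \<open>F\<close> halts on component
  \<open>\<langle>m, a\<rangle>\<close>.  Given a solution \<open>q\<close>, one guesses that \<open>F\<close> diverges on this component if \<open>q m = a\<close>, and
  waits for the value of \<open>F\<close> otherwise.\<close>

lemma stashing_le_DIS:
  assumes rep: "in_rep g = baire_rep" and F: "computable_pfun (\<lambda>p n. F p)"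
    and sol: "\<And>x. \<exists>y. out_rep g (\<lambda>_. case F x of None \<Rightarrow> 0 | Some v \<Rightarrow> Suc v) = Some y \<and> y \<in> sol g x"
  shows "\<Sigma>\<^sub>P g \<le>\<^sub>W DIS"
proof -
  obtain c where c: "\<And>p n. run p c n = F p" using F unfolding computable_pfun_def by blast
  have "computable_pfun (\<lambda>p z. F (seq_proj (odds p) (cpair (cfst z) (csnd z))))"
    using computable_pfun_oracle[OF F, of "\<lambda>p z. seq_proj (odds p) (cpair (cfst z) (csnd z))" "\<lambda>p z. z"]
    by (simp add: computable_intros)
  then obtain s where s: "computable_pfun s"
    "\<And>p m. s p m = None \<longleftrightarrow> (\<forall>a. F (seq_proj (odds p) (cpair m a)) = None)"
    "\<And>p m a. s p m = Some a \<Longrightarrow> F (seq_proj (odds p) (cpair m a)) \<noteq> None"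
    using computable_pfun_search[of "\<lambda>p m a. F (seq_proj (odds p) (cpair m a))"] by blast
  obtain d where d: "\<And>p n. run p d n = s p n" using s(1) unfolding computable_pfun_def by blast
  \<comment> \<open>Program \<open>d\<close> is run by \<open>U\<close> with oracle
    \<open>join (\<lambda>_. 0) p\<close>, whose odd half is the given sequence of
    instances.\<close>
  define k where "k p = join (ncons (encode d) (\<lambda>_. 0)) p" for p
  have k: "computable_fun k" unfolding k_def by (intro computable_intros)
  \<comment> \<open>Position \<open>w\<close> belongs to component \<open>cfst w\<close>, and its
    entry number proposes a value \<open>v\<close> with a certificate. After decrementing, 1 stands
    for the default 0, \<open>v + 2\<close> for the bound \<open>v + 1\<close>, and 0 is
    padding.\<close>
  define h where "h z w = (if odds z (cfst (cfst w)) = csnd (cfst w) then 1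
     else if computes_by (seq_proj (evens z) (cfst w)) (csnd (cfst (csnd w))) (encode c) 0 (cfst (cfst (csnd w)))
     then cfst (cfst (csnd w)) + 2 else 0)" for z w
  have h: "computable_fun h"
    unfolding h_def by (intro computable_intros computable_pred_computes_by_oracle)
  show ?thesis
  proof (rule weihrauch_leI[OF k h])
    fix P x assume "in_rep (\<Sigma>\<^sub>P g) P = Some x"
    then have x: "x = seq_proj P"
      by (simp add: stashing_def seq_rep_def rep baire_rep_def)
    have dom: "sol g y \<noteq> {}" for y using sol[of y] by blast
    show "\<exists>x'. in_rep DIS (k P) = Some x' \<and> x' \<in> pdom DIS \<and>
      (\<forall>q y. out_rep DIS q = Some y \<longrightarrow> y \<in> sol DIS x' \<longrightarrow>
        (\<exists>z. out_rep (\<Sigma>\<^sub>P g) (h (join P q)) = Some z \<and> z \<in> sol (\<Sigma>\<^sub>P g) x))"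
    proof (intro exI[of _ "k P"] conjI allI impI)
      show "in_rep DIS (k P) = Some (k P)" "k P \<in> pdom DIS"
        by (simp_all add: DIS_def baire_rep_def pdom_DIS[unfolded DIS_def])
      fix q y assume "out_rep DIS q = Some y" "y \<in> sol DIS (k P)"
      then have q: "U (k P) \<noteq> Some q" by (simp add: DIS_def baire_rep_def)
      \<comment> \<open>If all guesses were wrong, \<open>F\<close> would converge on component
        \<langle>m, a\<rangle> exactly for \<open>a = q m\<close>; the search would then return
        \<open>q m\<close> for every \<open>m\<close>, and \<open>q\<close> would be the forbidden
        function.\<close>
      have "\<exists>n. (F (seq_proj P n) = None) = (q (cfst n) = csnd n)"
      proof (rule ccontr)
        assume "\<not> ?thesis"
        then have *: "F (seq_proj P (cpair m a)) \<noteq> None \<longleftrightarrow> q m = a" for m a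
          by (metis cfst_cpair csnd_cpair)
        have "run (join (\<lambda>_. 0) P) d m = Some (q m)" for m
        proof -
          have "s (join (\<lambda>_. 0) P) m \<noteq> None" using s(2)[of "join (\<lambda>_. 0) P" m] *[of m "q m"] by auto
          then obtain a where a: "s (join (\<lambda>_. 0) P) m = Some a" by auto
          with s(3)[OF a] *[of m a] show ?thesis by (simp add: d)
        qed
        then show False using q by (simp add: k_def U_join)
      qed
      then obtain n where n: "(F (seq_proj P n) = None) = (q (cfst n) = csnd n)" ..
      define t where "t = h (join P q)"
      have "minus_one (seq_proj t n) = Some (\<lambda>_. case F (seq_proj P n) of None \<Rightarrow> 0 | Some v \<Rightarrow> Suc v)"
      proof (cases "F (seq_proj P n)")
        case None
        then have "seq_proj t n = (\<lambda>k. Suc 0)"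
          using n by (auto simp: t_def h_def seq_proj_def)
        then show ?thesis using None minus_one_Suc[of "\<lambda>_. 0"] by simp
      next
        case (Some v)
        have t: "seq_proj t n j = (if computes_by (seq_proj P n) (csnd (cfst j)) (encode c) 0 (cfst (cfst j))
          then cfst (cfst j) + 2 else 0)" for j
          using n Some by (simp add: t_def h_def seq_proj_def[of "h _"])
        have v: "phi (seq_proj P n) (encode c) 0 = Some v" by (simp add: c Some)
        then obtain l where l: "computes_by (seq_proj P n) l (encode c) 0 v"
          using phi_eq_Some_iff by blast
        \<comment> \<open>The last component \<open>j\<close> of the position is free, so one
          correct certificate yields infinitely many nonzero entries.\<close>
        have "seq_proj t n (cpair (cpair v l) j) \<noteq> 0" for j by (simp add: t l)
        then have "range (cpair (cpair v l)) \<subseteq> {j. seq_proj t n j \<noteq> 0}" by blast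
        moreover have "inj (cpair (cpair v l))" by (rule injI) simp
        ultimately have "infinite {j. seq_proj t n j \<noteq> 0}"
          using finite_subset range_inj_infinite by blast
        moreover have "seq_proj t n j = Suc (Suc v)" if "seq_proj t n j \<noteq> 0" for j
        proof -
          have *: "computes_by (seq_proj P n) (csnd (cfst j)) (encode c) 0 (cfst (cfst j))"
            using that by (auto simp: t split: if_splits)
          then have "phi (seq_proj P n) (encode c) 0 = Some (cfst (cfst j))"
            using phi_eq_Some_iff by blast
          then show ?thesis using v * by (simp add: t)
        qed
        ultimately show ?thesis using minus_one_const[of "seq_proj t n" "Suc v"] Some by simp
      qed
      moreover obtain z where "out_rep g (\<lambda>_. case F (seq_proj P n) of None \<Rightarrow> 0 | Some v \<Rightarrow> Suc v) = Some z"
          "z \<in> sol g (seq_proj P n)"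
        using sol by blast
      ultimately have z: "Option.bind (minus_one (seq_proj t n)) (out_rep g) = Some z"
        "z \<in> sol g (x n)" by (simp_all add: x)
      define Y where "Y m = Option.bind (minus_one (seq_proj t m)) (out_rep g)" for m
      have "out_rep (\<Sigma>\<^sub>P g) t = Some Y"
        by (simp add: stashing_def seq_rep_def completion_rep_def Y_def[abs_def])
      moreover have "Y \<in> sol (\<Sigma>\<^sub>P g) x"
      proof -
        have "Y m \<in> ran (completion_rep (out_rep g))" for m
          unfolding ran_def completion_rep_def Y_def by blast
        moreover have "Y n = Some z" using z(1) by (simp add: Y_def)
        ultimately show ?thesis using z(2) dom by (auto simp: stashing_def pdom_def)
      qed
      ultimately show "\<exists>z. out_rep (\<Sigma>\<^sub>P g) (h (join P q)) = Some z \<and> z \<in> sol (\<Sigma>\<^sub>P g) x"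
        unfolding t_def by blast
    qed
  qed
qed

text \<open>Lets a position be recognised as that of the \<open>l\<close>-th nonzero entry by
  counting its predecessors, without waiting for the entry to appear.\<close>

lemma card_less_enumerate:
  assumes N: "infinite (N :: nat set)"
  shows "card {j \<in> N. j < enumerate N l} = l"
proof -
  have "{j \<in> N. j < enumerate N l} = enumerate N ` {..<l}"
  proof (intro equalityI subsetI)
    fix j assume j: "j \<in> {j \<in> N. j < enumerate N l}"
    then obtain i where i: "enumerate N i = j" using enumerate_Ex[OF N, of j] by blast
    then have "i < l" using j enumerate_mono_iff[OF N, of i l] by simp
    then show "j \<in> enumerate N ` {..<l}" using i by blast
  next
    fix j assume "j \<in> enumerate N ` {..<l}"
    then show "j \<in> {j \<in> N. j < enumerate N l}"
      using enumerate_in_set[OF N] enumerate_mono_iff[OF N] by auto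
  qed
  then show ?thesis
    using inj_enumerate[OF N] by (simp add: card_image inj_on_subset)
qed

lemma computable_fun_count:
  assumes "computable_pred (\<lambda>p z. P p (cfst z) (csnd z))" "computable_fun b"
  shows "computable_fun (\<lambda>p n. card {j. j < b p n \<and> P p n j})"
proof -
  have [simp]: "{j. j < Suc m \<and> Q j} = (if Q m then insert m {j. j < m \<and> Q j} else {j. j < m \<and> Q j})"
    for Q and m :: nat by (auto simp: less_Suc_eq)
  have "card {j. j < m \<and> Q j} = rec_nat 0 (\<lambda>j r. r + (if Q j then 1 else 0)) m" for Q m
    by (induction m) simp_all
  moreover have "computable_pred (\<lambda>p z. P p (cfst z) (cfst (csnd z)))"
    using computable_pred_comp[OF assms(1), of "\<lambda>p z. cpair (cfst z) (cfst (csnd z))"]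
    by (simp add: computable_intros)
  then have "computable_fun (\<lambda>p n. rec_nat 0 (\<lambda>j r. r + (if P p n j then 1 else 0)) (b p n))"
    by (intro computable_intros assms)
  ultimately show ?thesis by simp
qed

text \<open>A solution \<open>t\<close> of the stashed problem is written into a point \<open>q\<close> such that the \<open>l\<close>-th value of
  component \<open>n\<close>, incremented by one, is the only nonzero entry of \<open>q\<langle>\<langle>n, l\<rangle>, \<cdot>\<rangle>\<close>.  If \<open>U p = q\<close>,
  then \<open>F\<close> finds this entry, and so all bounds in \<open>t\<close> are wrong.\<close>

lemma DIS_le_stashing:
  assumes problem: "is_problem g" and rep: "in_rep g = baire_rep" and dom: "pdom g = UNIV"
    and trans: "\<And>F. computable_pfun F \<Longrightarrow> \<exists>k. computable_fun (\<lambda>p z. k p (cfst z) (csnd z)) \<and>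
      (\<forall>p n r y. out_rep g r = Some y \<longrightarrow> y \<in> sol g (k p n) \<longrightarrow> (\<exists>l. not_geq (F p (cpair n l)) (r l)))"
  shows "DIS \<le>\<^sub>W \<Sigma>\<^sub>P g"
proof -
  define f where "f p n = phi (join (ntl (evens p)) (odds p)) (p 0) n" for p n
  have f: "computable_pfun (\<lambda>p n. f p (m p n))" if "computable_fun m" for m
    unfolding f_def by (intro computable_pfun_phi_oracle computable_intros that)
  \<comment> \<open>Restricts the possible forbidden function to its nonzero values in row
    \<open>z\<close>, so that \<open>F\<close> halts on a row only after meeting such an
    entry.\<close>
  define e where "e p z m = Option.bind (f p (cpair z m)) (\<lambda>v. if v \<noteq> 0 then Some v else None)" for p z m
  have e: "computable_pfun (\<lambda>p n. e p (i p n) (m p n))" if "computable_fun i" "computable_fun m" for i m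
    unfolding e_def by (intro computable_pfun_bind computable_pfun_guard f computable_intros that)
  obtain s where s: "computable_pfun s" "\<And>p z. s p z = None \<longleftrightarrow> (\<forall>m. e p z m = None)"
    "\<And>p z m. s p z = Some m \<Longrightarrow> e p z m \<noteq> None"
    using computable_pfun_search[of e] e by (auto simp: computable_intros)
  define F where "F p z = Option.bind (s p z) (\<lambda>m. e p z m)" for p z
  have "computable_pfun F"
    unfolding F_def by (intro computable_pfun_bind s(1) e computable_intros)
  from trans[OF this] obtain k where k: "computable_fun (\<lambda>p z. k p (cfst z) (csnd z))"
    and kF: "\<And>p n r y. out_rep g r = Some y \<Longrightarrow> y \<in> sol g (k p n) \<Longrightarrow>
      \<exists>l. not_geq (F p (cpair n l)) (r l)"
    by blast
  define t where "t z n = seq_proj (odds z) n" for z :: baire and n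
  define h where "h z w = (if t z (cfst (cfst w)) (csnd w) \<noteq> 0 \<and>
      card {j. j < csnd w \<and> t z (cfst (cfst w)) j \<noteq> 0} = csnd (cfst w)
      then t z (cfst (cfst w)) (csnd w) else 0)" for z w
  have h: "computable_fun h"
    unfolding h_def t_def by (intro computable_intros computable_fun_count)
  show ?thesis
  proof (rule weihrauch_leI[OF k h])
    fix p x assume "in_rep DIS p = Some x"
    then have x: "x = p" by (simp add: DIS_def baire_rep_def)
    have in_rep: "in_rep (\<Sigma>\<^sub>P g) (\<lambda>z. k p (cfst z) (csnd z)) = Some (k p)"
      by (simp add: stashing_def seq_rep_def rep baire_rep_def seq_proj_def[abs_def])
    have sol: "sol (\<Sigma>\<^sub>P g) (k p) = {y. (\<forall>n. y n \<in> ran (completion_rep (out_rep g))) \<and>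
        (\<exists>n. \<exists>z \<in> sol g (k p n). y n = Some z)}"
      by (simp add: stashing_def dom)
    show "\<exists>x'. in_rep (\<Sigma>\<^sub>P g) (\<lambda>z. k p (cfst z) (csnd z)) = Some x' \<and> x' \<in> pdom (\<Sigma>\<^sub>P g) \<and>
      (\<forall>q y. out_rep (\<Sigma>\<^sub>P g) q = Some y \<longrightarrow> y \<in> sol (\<Sigma>\<^sub>P g) x' \<longrightarrow>
        (\<exists>z. out_rep DIS (h (join p q)) = Some z \<and> z \<in> sol DIS x))"
    proof (intro exI[of _ "k p"] conjI allI impI in_rep)
      show "k p \<in> pdom (\<Sigma>\<^sub>P g)" by (simp add: pdom_stashing[OF problem] dom)
      fix q y assume "out_rep (\<Sigma>\<^sub>P g) q = Some y" "y \<in> sol (\<Sigma>\<^sub>P g) (k p)"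
      then obtain n z where n: "z \<in> sol g (k p n)" "y n = Some z"
        and "y = (\<lambda>n. Option.bind (minus_one (seq_proj q n)) (out_rep g))"
        unfolding sol by (auto simp: stashing_def seq_rep_def completion_rep_def)
      then obtain r where r: "minus_one (seq_proj q n) = Some r" "out_rep g r = Some z"
        by (auto simp: bind_eq_Some_conv)
      then obtain l where l: "not_geq (F p (cpair n l)) (r l)" using kF n(1) by blast
      define N where "N = {j. seq_proj q n j \<noteq> 0}"
      have N: "infinite N" and rl: "r l = seq_proj q n (enumerate N l) - 1"
        using r(1) by (auto simp: minus_one_def N_def split: if_splits)
      define q' where "q' = h (join p q)"
      have q': "q' (cpair (cpair n l) m) =
          (if m \<in> N \<and> card {j \<in> N. j < m} = l then seq_proj q n m else 0)" for m
        by (simp add: q'_def h_def t_def N_def conj_commute)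
      have unique: "m = enumerate N l" if "q' (cpair (cpair n l) m) \<noteq> 0" for m
      proof -
        have "m \<in> N" "card {j \<in> N. j < m} = l" using that by (auto simp: q' split: if_splits)
        moreover obtain i where "enumerate N i = m" using enumerate_Ex[OF N \<open>m \<in> N\<close>] by blast
        ultimately show ?thesis using card_less_enumerate[OF N] by metis
      qed
      \<comment> \<open>The increment is inherited from the coding of the completion; it makes the
        entry visible to the search even if \<open>r l\<close> is 0.\<close>
      have val: "q' (cpair (cpair n l) (enumerate N l)) = Suc (r l)"
        using enumerate_in_set[OF N, of l] card_less_enumerate[OF N, of l] by (auto simp: q' rl N_def)
      have "U p \<noteq> Some q'"
      proof
        assume "U p = Some q'"
        then have "f p m = Some (q' m)" for m
          using U_join[of "p 0" "ntl (evens p)" "odds p" q'] ncons_ntl[of "evens p"]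
          by (simp add: f_def evens_def[of p 0])
        then have ep: "e p (cpair n l) m = (if q' (cpair (cpair n l) m) \<noteq> 0 then Some (q' (cpair (cpair n l) m)) else None)"
          for m by (simp add: e_def)
        have "s p (cpair n l) \<noteq> None"
          using val s(2)[of p "cpair n l"] ep[of "enumerate N l"] by auto
        then obtain m where m: "s p (cpair n l) = Some m" by auto
        then have "q' (cpair (cpair n l) m) \<noteq> 0"
          using s(3)[OF m] ep[of m] by (auto split: if_splits)
        then have "F p (cpair n l) = Some (Suc (r l))"
          using unique[of m] val ep[of m] m by (simp add: F_def)
        with l show False by (simp add: not_geq_def)
      qed
      then show "\<exists>z. out_rep DIS (h (join p q)) = Some z \<and> z \<in> sol DIS x"
        by (simp add: DIS_def baire_rep_def x q'_def)
    qed
  qed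
qed

section \<open>Stashings of the two concrete problems\<close>

lemma stashing_NGEQ_le_DIS: "\<Sigma>\<^sub>P NGEQ \<le>\<^sub>W DIS"
proof (rule stashing_le_DIS)
  show "computable_pfun (\<lambda>p n. phi (ntl p) (cfst (p 0)) (csnd (p 0)))"
    by (intro computable_pfun_phi_oracle computable_intros)
qed (auto simp: NGEQ_def baire_rep_def nat_rep_def not_geq_def split: option.splits)

text \<open>It suffices to escape at argument 0, so the constant sequence built from that single
  value is already a solution.\<close>

lemma stashing_NMAJ_le_DIS: "\<Sigma>\<^sub>P NMAJ \<le>\<^sub>W DIS"
proof (rule stashing_le_DIS)
  show "computable_pfun (\<lambda>p n. phi (ntl p) (p 0) 0)"
    by (intro computable_pfun_phi_oracle computable_intros)
qed (auto simp: NMAJ_def baire_rep_def not_geq_def intro!: exI[of _ 0] split: option.splits)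

text \<open>An answer of \<open>NGEQ\<close> is one number, read off the first entry of its name;
  hence each component asks only about \<open>l = 0\<close>.\<close>

lemma DIS_le_stashing_NGEQ: "DIS \<le>\<^sub>W \<Sigma>\<^sub>P NGEQ"
proof (rule DIS_le_stashing)
  fix F :: "baire \<Rightarrow> nat \<Rightarrow> nat option" assume "computable_pfun F"
  then obtain c where c: "\<And>p n. run p c n = F p n" unfolding computable_pfun_def by blast
  show "\<exists>k. computable_fun (\<lambda>p z. k p (cfst z) (csnd z)) \<and>
      (\<forall>p n r y. out_rep NGEQ r = Some y \<longrightarrow> y \<in> sol NGEQ (k p n) \<longrightarrow> (\<exists>l. not_geq (F p (cpair n l)) (r l)))"
  proof (intro exI conjI)
    show "computable_fun (\<lambda>p z. ncons (cpair (encode c) (cpair (cfst z) 0)) p (csnd z))"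
      by (intro computable_intros)
  qed (auto simp: sol_NGEQ c, simp add: NGEQ_def nat_rep_def, metis)
qed (simp_all add: is_problem_basic, simp_all add: NGEQ_def pdom_NGEQ[unfolded NGEQ_def])

lemma DIS_le_stashing_NMAJ: "DIS \<le>\<^sub>W \<Sigma>\<^sub>P NMAJ"
proof (rule DIS_le_stashing)
  fix F :: "baire \<Rightarrow> nat \<Rightarrow> nat option" assume F: "computable_pfun F"
  have "computable_pfun (\<lambda>p l. F (\<lambda>j. ntl p j) (cpair (p 0) l))"
    by (intro computable_pfun_oracle[OF F] computable_intros)
  then obtain c where c: "\<And>p n. run p c n = F (ntl p) (cpair (p 0) n)"
    unfolding computable_pfun_def by auto
  show "\<exists>k. computable_fun (\<lambda>p z. k p (cfst z) (csnd z)) \<and>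
      (\<forall>p n r y. out_rep NMAJ r = Some y \<longrightarrow> y \<in> sol NMAJ (k p n) \<longrightarrow> (\<exists>l. not_geq (F p (cpair n l)) (r l)))"
  proof (intro exI conjI)
    show "computable_fun (\<lambda>p z. ncons (encode c) (ncons (cfst z) p) (csnd z))"
      by (intro computable_intros)
  qed (auto simp: sol_NMAJ c, auto simp: NMAJ_def baire_rep_def)
qed (simp_all add: is_problem_basic,simp_all add: NMAJ_def pdom_NMAJ[unfolded NMAJ_def])

text \<open>The same program is handed over with its oracle. Where it diverges or stays below
  \<open>q\<close>, it cannot have the value of \<open>q\<close>, so \<open>q\<close> itself avoids
  the forbidden function.\<close>

lemma DIS_le_NMAJ: "DIS \<le>\<^sub>W NMAJ"
proof (rule weihrauch_leI)
  show "computable_fun (\<lambda>p. ncons (p 0) (join (ntl (evens p)) (odds p)))" "computable_fun odds"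
    by (intro computable_intros)+
  fix p x assume "in_rep DIS p = Some x"
  then have x: "x = p" by (simp add: DIS_def baire_rep_def)
  have "U p \<noteq> Some q" if "not_geq (phi (join (ntl (evens p)) (odds p)) (p 0) n) (q n)" for q n
  proof
    assume "U p = Some q"
    then have "phi (join (ntl (evens p)) (odds p)) (p 0) n = Some (q n)"
      using U_join[of "p 0" "ntl (evens p)" "odds p" q] ncons_ntl[of "evens p"]
      by (simp add: evens_def[of p 0])
    with that show False by (simp add: not_geq_def)
  qed
  then show "\<exists>x'. in_rep NMAJ (ncons (p 0) (join (ntl (evens p)) (odds p))) = Some x' \<and> x' \<in> pdom NMAJ \<and>
        (\<forall>q y. out_rep NMAJ q = Some y \<longrightarrow> y \<in> sol NMAJ x' \<longrightarrow>
          (\<exists>z. out_rep DIS (odds (join p q)) = Some z \<and> z \<in> sol DIS x))"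
    by (simp add: pdom_NMAJ) (auto simp: NMAJ_def DIS_def baire_rep_def x)
qed

section \<open>Hyperimmunity\<close>

text \<open>Component \<open>j\<close> runs \<phi> with index \<open>j\<close> on \<langle>j,
  n\<rangle> instead of \<open>n\<close>. Escaping there happens in row \<open>j\<close> of the name
  \<open>q\<close> of the whole sequence, so \<open>q\<close> can be returned unchanged.\<close>

lemma HYP_le_parallel_NMAJ: "HYP \<le>\<^sub>s\<^sub>W \<Pi>\<^sub>P NMAJ"
proof -
  have "computable_pfun (\<lambda>q n. phi (ntl q) (q 0) (cpair (q 0) n))"
    by (intro computable_pfun_phi_oracle computable_intros)
  then obtain c where c: "\<And>q n. run q c n = phi (ntl q) (q 0) (cpair (q 0) n)"
    unfolding computable_pfun_def by blast
  define k where "k p z = ncons (encode c) (ncons (cfst z) p) (csnd z)" for p z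
  show ?thesis
  proof (rule strong_weihrauch_leI)
    show "computable_fun k" "computable_fun (\<lambda>q. q)"
      unfolding k_def by (intro computable_intros)+
    fix p x assume "in_rep HYP p = Some x"
    then have x: "x = p" by (simp add: HYP_def baire_rep_def)
    let ?x' = "\<lambda>j. ncons (encode c) (ncons j p)"
    have "in_rep (\<Pi>\<^sub>P NMAJ) (k p) = Some ?x'"
      by (simp add: parallelization_def seq_rep_def NMAJ_def baire_rep_def seq_proj_def[abs_def] k_def)
    moreover have "q \<in> sol HYP p" if q: "seq_proj q \<in> sol (\<Pi>\<^sub>P NMAJ) ?x'" for q
    proof -
      have "\<exists>n. r n < q n" if r: "r \<le>\<^sub>T p" for r
      proof -
        obtain j where j: "\<And>n. phi p j n = Some (r n)" using r unfolding turing_le_def by blast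
        have "\<exists>n. not_geq (phi p j (cpair j n)) (q (cpair j n))"
          using q by (simp add: parallelization_def pdom_NMAJ sol_NMAJ c seq_proj_def)
        then show ?thesis by (auto simp: j not_geq_def)
      qed
      then show ?thesis by (simp add: HYP_def)
    qed
    ultimately show "\<exists>x'. in_rep (\<Pi>\<^sub>P NMAJ) (k p) = Some x' \<and> x' \<in> pdom (\<Pi>\<^sub>P NMAJ) \<and>
        (\<forall>q y. out_rep (\<Pi>\<^sub>P NMAJ) q = Some y \<longrightarrow> y \<in> sol (\<Pi>\<^sub>P NMAJ) x' \<longrightarrow>
          (\<exists>z. out_rep HYP q = Some z \<and> z \<in> sol HYP x))"
      by (auto simp: pdom_parallelization pdom_NMAJ x)
        (auto simp: parallelization_def seq_rep_def NMAJ_def HYP_def baire_rep_def)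
  qed
qed

lemma total_valued: "\<not> (\<exists>n. f n = None) \<Longrightarrow> \<exists>r. \<forall>n. f n = Some (r n)"
  by (rule exI[of _ "\<lambda>n. the (f n)"]) auto

text \<open>A divergent program is escaped by everything, a total one computes a function below
  \<open>p\<close>. Allowing any \<open>x\<close> below \<open>p\<close> lets one \<open>q\<close>
  serve all components of a parallelization.\<close>

lemma NMAJ_of_hyperimmune:
  assumes "q \<in> sol HYP p" "x \<le>\<^sub>T p" shows "q \<in> sol NMAJ x"
proof (cases "\<exists>n. phi (ntl x) (x 0) n = None")
  case True
  then obtain n where "phi (ntl x) (x 0) n = None" ..
  then show ?thesis by (auto simp: NMAJ_def not_geq_def intro!: exI[of _ n])
next
  case False
  then obtain r where r: "\<And>n. phi (ntl x) (x 0) n = Some (r n)" using total_valued by blast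
  then have "r \<le>\<^sub>T ntl x" unfolding turing_le_def by blast
  moreover have "ntl x \<le>\<^sub>T x" by (intro computable_fun_turing_le computable_intros)
  ultimately have "r \<le>\<^sub>T p" using assms(2) turing_trans by blast
  then obtain n where "r n < q n" using assms(1) by (auto simp: HYP_def)
  then show ?thesis by (auto simp: NMAJ_def not_geq_def r)
qed

lemma parallel_NMAJ_le_HYP: "\<Pi>\<^sub>P NMAJ \<le>\<^sub>s\<^sub>W HYP"
proof (rule strong_weihrauch_leI)
  show "computable_fun (\<lambda>p. p)" "computable_fun (\<lambda>q z. q (csnd z))"
    by (intro computable_intros)+
  fix p x assume "in_rep (\<Pi>\<^sub>P NMAJ) p = Some x"
  then have x: "x = seq_proj p"
    by (simp add: parallelization_def seq_rep_def NMAJ_def baire_rep_def)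
  have "seq_proj p n \<le>\<^sub>T p" for n
    by (intro computable_fun_turing_le[of "\<lambda>p. seq_proj p n"] computable_intros)
  then have sol: "(\<lambda>n. q) \<in> sol (\<Pi>\<^sub>P NMAJ) x" if "q \<in> sol HYP p" for q
    using NMAJ_of_hyperimmune[OF that] by (simp add: x parallelization_def pdom_NMAJ)
  have "out_rep (\<Pi>\<^sub>P NMAJ) (\<lambda>z. q (csnd z)) = Some (\<lambda>n. q)" for q
    by (simp add: parallelization_def seq_rep_def NMAJ_def baire_rep_def seq_proj_def[abs_def])
  then show "\<exists>x'. in_rep HYP p = Some x' \<and> x' \<in> pdom HYP \<and>
        (\<forall>q y. out_rep HYP q = Some y \<longrightarrow> y \<in> sol HYP x' \<longrightarrow>
          (\<exists>z. out_rep (\<Pi>\<^sub>P NMAJ) (\<lambda>z. q (csnd z)) = Some z \<and> z \<in> sol (\<Pi>\<^sub>P NMAJ) x))"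
    using sol by (auto simp: pdom_HYP) (simp add: HYP_def baire_rep_def)
qed

lemma NMAJ_le_HYP: "NMAJ \<le>\<^sub>W HYP"
proof (rule weihrauch_leI)
  show "computable_fun (\<lambda>p. p)" "computable_fun odds"
    by (intro computable_intros)+
  fix p x assume "in_rep NMAJ p = Some x"
  then have "x = p" by (simp add: NMAJ_def baire_rep_def)
  then have "q \<in> sol NMAJ x" if "q \<in> sol HYP p" for q
    using NMAJ_of_hyperimmune[OF that turing_refl] by simp
  then show "\<exists>x'. in_rep HYP p = Some x' \<and> x' \<in> pdom HYP \<and>
        (\<forall>q y. out_rep HYP q = Some y \<longrightarrow> y \<in> sol HYP x' \<longrightarrow>
          (\<exists>z. out_rep NMAJ (odds (join p q)) = Some z \<and> z \<in> sol NMAJ x))"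
    by (simp add: pdom_HYP) (simp add: HYP_def NMAJ_def baire_rep_def)
qed

text \<open>Any name of the degree computes some hyperimmune \<open>y\<close>. Were the name
  computable from \<open>p\<close>, then \<open>y\<close> would be among the functions that
  \<open>y\<close> has to exceed somewhere.\<close>

lemma NON_le_HYP_degree: "NON \<le>\<^sub>W HYP\<^sup>D"
proof (rule weihrauch_leI)
  show "computable_fun (\<lambda>p. p)" "computable_fun odds"
    by (intro computable_intros)+
  fix p x assume "in_rep NON p = Some x"
  then have x: "x = p" by (simp add: NON_def baire_rep_def)
  have "\<not> q \<le>\<^sub>T p" if q: "deg q \<in> sol (HYP\<^sup>D) p" for q
  proof
    assume "q \<le>\<^sub>T p"
    obtain s y where s: "deg q = deg s" "y \<in> sol HYP p" "y \<le>\<^sub>T s"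
      using q by (auto simp: degree_version_def HYP_def baire_rep_def)
    have "s \<in> deg q" using s(1) turing_refl by (simp add: deg_def)
    then have "y \<le>\<^sub>T p" using s(3) \<open>q \<le>\<^sub>T p\<close> turing_trans unfolding deg_def by blast
    then show False using s(2) by (auto simp: HYP_def)
  qed
  then show "\<exists>x'. in_rep (HYP\<^sup>D) p = Some x' \<and> x' \<in> pdom (HYP\<^sup>D) \<and>
        (\<forall>q y. out_rep (HYP\<^sup>D) q = Some y \<longrightarrow> y \<in> sol (HYP\<^sup>D) x' \<longrightarrow>
          (\<exists>z. out_rep NON (odds (join p q)) = Some z \<and> z \<in> sol NON x))"
    unfolding pdom_degree_version[OF is_problem_basic(3)] pdom_HYP x
    by (simp add: NON_def baire_rep_def) (simp add: degree_version_def HYP_def baire_rep_def degree_rep_def)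
qed

section \<open>Separations by computable solutions and by self-reference\<close>

lemma not_HYP_le_NMAJ: "\<not> HYP \<le>\<^sub>W NMAJ"
proof
  assume "HYP \<le>\<^sub>W NMAJ"
  then have "\<exists>k c. computable_fun k \<and> (\<forall>p q. q \<in> sol NMAJ (k p) \<longrightarrow>
    (\<exists>r. (\<forall>n. run (join p q) c n = Some (r n)) \<and> (\<exists>z. out_rep HYP r = Some z \<and> z \<in> sol HYP p)))"
    by (rule weihrauch_le_baireD) (simp_all add: is_problem_basic pdom_HYP, simp_all add: HYP_def NMAJ_def)
  then obtain k c where k: "computable_fun k" and
    kc: "\<And>p q. q \<in> sol NMAJ (k p) \<Longrightarrow> \<exists>r. (\<forall>n. run (join p q) c n = Some (r n)) \<and> r \<in> sol HYP p"
    by (auto simp: HYP_def baire_rep_def)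
  define p :: baire where "p = (\<lambda>_. 0)"
  define x where "x = k p"
  have x: "x \<le>\<^sub>T p" unfolding x_def by (rule computable_fun_turing_le[OF k])
  \<comment> \<open>The case distinction is nonuniform: only the existence of a solution below
    \<open>x\<close> matters, not how to find it from \<open>x\<close>.\<close>
  have "\<exists>q. q \<le>\<^sub>T x \<and> q \<in> sol NMAJ x"
  proof (cases "\<exists>n. phi (ntl x) (x 0) n = None")
    case True
    then obtain n where "phi (ntl x) (x 0) n = None" ..
    then have "(\<lambda>_. 0) \<in> sol NMAJ x" by (auto simp: NMAJ_def not_geq_def intro!: exI[of _ n])
    moreover have "(\<lambda>_. 0) \<le>\<^sub>T x"
      by (intro computable_fun_turing_le[of "\<lambda>p n. 0"] computable_intros)
    ultimately show ?thesis by blast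
  next
    case False
    then obtain r where r: "\<And>n. phi (ntl x) (x 0) n = Some (r n)" using total_valued by blast
    then have "r \<le>\<^sub>T ntl x" unfolding turing_le_def by blast
    moreover have "ntl x \<le>\<^sub>T x" by (intro computable_fun_turing_le computable_intros)
    moreover have "(\<lambda>n. Suc (r n)) \<le>\<^sub>T r"
      by (intro computable_fun_turing_le[of "\<lambda>p n. Suc (p n)"] computable_intros)
    moreover have "(\<lambda>n. Suc (r n)) \<in> sol NMAJ x" by (auto simp: NMAJ_def not_geq_def r)
    ultimately show ?thesis using turing_trans by blast
  qed
  then obtain q where q: "q \<le>\<^sub>T x" "q \<in> sol NMAJ x" by blast
  then obtain r where r: "\<And>n. run (join p q) c n = Some (r n)" "r \<in> sol HYP p"
    using kc x_def by blast
  have "r \<le>\<^sub>T join p q" using r(1) unfolding turing_le_iff by blast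
  moreover have "join p q \<le>\<^sub>T q"
    unfolding p_def by (intro computable_fun_turing_le[of "\<lambda>q. join (\<lambda>_. 0) q"] computable_intros)
  ultimately have "r \<le>\<^sub>T p" using q(1) x turing_trans by blast
  then show False using r(2) by (auto simp: HYP_def)
qed

text \<open>Self-reference comes for free: on the instance \<open>i i i \<dots>\<close> the program \<open>i\<close> can read its own
  index from the oracle.  Of the two candidates \<open>0 0 0 \<dots>\<close> and \<open>1 1 1 \<dots>\<close> for a solution of
  \<open>DIS\<close>, at least one is correct, and as soon as the first value of the forbidden function is known,
  so is a correct candidate; until then the program waits for both candidates.\<close>

lemma not_NMAJ_le_DIS: "\<not> NMAJ \<le>\<^sub>W DIS"
proof
  assume "NMAJ \<le>\<^sub>W DIS"
  then have "\<exists>k c. computable_fun k \<and> (\<forall>p q. q \<in> sol DIS (k p) \<longrightarrow>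
    (\<exists>r. (\<forall>n. run (join p q) c n = Some (r n)) \<and> (\<exists>z. out_rep NMAJ r = Some z \<and> z \<in> sol NMAJ p)))"
    by (rule weihrauch_le_baireD) (simp_all add: is_problem_basic pdom_NMAJ, simp_all add: NMAJ_def DIS_def)
  then obtain k c where k: "computable_fun k" and
    kc: "\<And>p q. q \<in> sol DIS (k p) \<Longrightarrow> \<exists>r. (\<forall>n. run (join p q) c n = Some (r n)) \<and> r \<in> sol NMAJ p"
    by (auto simp: NMAJ_def baire_rep_def)
  define R where "R p j n = phi (join p (\<lambda>_. j)) (encode c) n" for p and j n :: nat
  define f where "f p = phi (join (ntl (evens (k p))) (odds (k p))) (k p 0) 0" for p
  \<comment> \<open>The sum dominates both candidate answers. \<open>B\<close> instead waits for the
    forbidden value at 0 and follows the constant that differs from it.\<close>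
  define A where "A p n = Option.bind (R p 0 n) (\<lambda>a. Option.bind (R p 1 n) (\<lambda>b. Some (a + b)))" for p n
  define B where "B p n = Option.bind (f p) (\<lambda>v. R p (if v = 0 then 1 else 0) n)" for p n
  have R: "computable_pfun (\<lambda>p n. R p (g p n) (h p n))" if "computable_fun g" "computable_fun h" for g h
    unfolding R_def
    by (intro computable_pfun_phi_oracle computable_intros computable_fun_comp[OF that(1)] that(2))
  have A: "computable_pfun A"
    unfolding A_def by (intro computable_pfun_bind R computable_intros)
  have B: "computable_pfun B"
    unfolding B_def f_def
    by (intro computable_pfun_bind R computable_pfun_phi_oracle computable_intros computable_fun_comp[OF k])
  obtain D where D: "computable_pfun D" "\<And>p n. D p n = None \<longleftrightarrow> A p n = None \<and> B p n = None"
    "\<And>p n v. D p n = Some v \<Longrightarrow> A p n = Some v \<or> B p n = Some v"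
    using computable_pfun_parallel[OF A B] by blast
  obtain d where d: "\<And>p n. run p d n = D p n" using D(1) unfolding computable_pfun_def by blast
  \<comment> \<open>Dropping the first entry leaves \<open>x\<close> unchanged, so as an instance of
    \<open>NMAJ\<close> it runs \<open>d\<close> relative to \<open>x\<close> itself.\<close>
  define x :: baire where "x = (\<lambda>_. encode d)"
  have "ntl x = x" "x 0 = encode d" by (simp_all add: x_def ntl_def[abs_def])
  then have sol: "sol NMAJ x = {q. \<exists>n. not_geq (D x n) (q n)}"
    by (simp add: NMAJ_def d)
  have contra: False if j: "(\<lambda>_. j) \<in> sol DIS (k x)"
    and le: "\<And>r n. (\<And>n. R x j n = Some (r n)) \<Longrightarrow> \<exists>v. D x n = Some v \<and> r n \<le> v" for j
  proof -
    obtain r where r: "\<And>n. R x j n = Some (r n)" "r \<in> sol NMAJ x"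
      using kc[OF j] by (auto simp: R_def)
    then obtain n where n: "not_geq (D x n) (r n)" by (auto simp: sol)
    obtain v where "D x n = Some v" "r n \<le> v" using le[of r n] r(1) by blast
    with n show False by (simp add: not_geq_def)
  qed
  have U0: "f x = Some (q 0)" if "U (k x) = Some q" for q
    using that U_join[of "k x 0" "ntl (evens (k x))" "odds (k x)" q] ncons_ntl[of "evens (k x)"]
    by (simp add: f_def evens_def[of "k x" 0])
  show False
  proof (cases "f x")
    case None
    then have all: "q \<in> sol DIS (k x)" for q using U0[of q] by (auto simp: DIS_def)
    obtain r1 where r1: "\<And>n. R x 1 n = Some (r1 n)"
      using kc[OF all[of "\<lambda>_. 1"]] by (auto simp: R_def)
    show False
    proof (rule contra[OF all[of "\<lambda>_. 0"]])
      fix r n assume r: "\<And>n. R x 0 n = Some (r n)"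
      have "A x n = Some (r n + r1 n)" "B x n = None"
        using r r1 None by (simp_all add: A_def B_def)
      then show "\<exists>v. D x n = Some v \<and> r n \<le> v"
        using D(2)[of x n] D(3)[of x n] by (cases "D x n") auto
    qed
  next
    case (Some v)
    define j where "j = (if v = 0 then 1 else 0 :: nat)"
    have "(\<lambda>_. j) \<in> sol DIS (k x)" using U0[of "\<lambda>_. j"] Some by (auto simp: DIS_def j_def)
    then show False
    proof (rule contra)
      fix r n assume r: "\<And>n. R x j n = Some (r n)"
      have B: "B x n = Some (r n)" using r Some by (simp add: B_def j_def)
      \<comment> \<open>If \<open>A\<close> wins the race, its sum still dominates the correct
        candidate.\<close>
      moreover have "r n \<le> w" if "A x n = Some w" for w
        using that r[of n] by (auto simp: A_def j_def bind_eq_Some_conv split: if_splits)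
      ultimately show "\<exists>v. D x n = Some v \<and> r n \<le> v"
        using D(2)[of x n] D(3)[of x n] by (cases "D x n") auto
    qed
  qed
qed

section \<open>A noncomputable set of hyperimmune-free degree\<close>

definition cantor :: "baire set" where "cantor = {A. \<forall>n. A n \<le> 1}"

text \<open>Koenig's lemma for decreasing properties. The path \<open>A\<close> need not satisfy any
  \<open>B m\<close>; its prefixes extend to points that do, and locality of computations does the
  rest in the applications.\<close>

lemma cantor_koenig:
  fixes B :: "nat \<Rightarrow> baire \<Rightarrow> bool"
  assumes ex: "\<And>m. \<exists>A \<in> cantor. B m A" and anti: "\<And>l m A. l \<le> m \<Longrightarrow> B m A \<Longrightarrow> B l A"
  shows "\<exists>A \<in> cantor. \<forall>m. \<exists>A' \<in> cantor. (\<forall>j<m. A' j = A j) \<and> B m A'"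
proof -
  define ext where "ext n x = (\<forall>m. \<exists>A \<in> cantor. (\<forall>j<n. A j = x j) \<and> B m A)" for n and x :: baire
  have step: "\<exists>b \<le> 1. ext (Suc n) (x(n := b))" if ext: "ext n x" for n x
  proof (rule ccontr)
    assume "\<not> ?thesis"
    then have "\<not> ext (Suc n) (x(n := 0))" "\<not> ext (Suc n) (x(n := 1))" by auto
    then obtain l m where
      l: "\<And>A. A \<in> cantor \<Longrightarrow> \<forall>j<Suc n. A j = (x(n := 0)) j \<Longrightarrow> \<not> B l A" and
      m: "\<And>A. A \<in> cantor \<Longrightarrow> \<forall>j<Suc n. A j = (x(n := 1)) j \<Longrightarrow> \<not> B m A"
      unfolding ext_def by blast
    \<comment> \<open>If the two one-bit extensions die at levels \<open>l\<close> and
      \<open>m\<close>, a point at level \<open>max l m\<close> has nowhere to go.\<close>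
    obtain A where A: "A \<in> cantor" "\<forall>j<n. A j = x j" "B (max l m) A"
      using ext unfolding ext_def by blast
    have "B l A" "B m A" using anti[OF _ A(3)] by simp_all
    moreover have "A n = 0 \<or> A n = 1" using A(1) by (auto simp: cantor_def le_Suc_eq)
    ultimately show False using l[OF A(1)] m[OF A(1)] A(2) by (auto simp: less_Suc_eq)
  qed
  have "\<exists>s. \<forall>n. ((\<forall>j. s n j \<le> 1) \<and> ext n (s n)) \<and> (\<exists>b. s (Suc n) = (s n)(n := b))"
  proof (rule dependent_nat_choice)
    show "\<exists>x. (\<forall>j. x j \<le> 1) \<and> ext 0 x" using ex by (intro exI[of _ "\<lambda>_. 0"]) (simp add: ext_def)
    fix x n assume x: "(\<forall>j. x j \<le> 1) \<and> ext n x"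
    with step[of n x] obtain b where "b \<le> 1" "ext (Suc n) (x(n := b))" by blast
    with x show "\<exists>y. ((\<forall>j. y j \<le> 1) \<and> ext (Suc n) y) \<and> (\<exists>b. y = x(n := b))"
      by (intro exI[of _ "x(n := b)"]) auto
  qed
  then obtain s where s: "\<And>n j. s n j \<le> 1" "\<And>n. ext n (s n)" "\<And>n. \<exists>b. s (Suc n) = (s n)(n := b)"
    by blast
  define A where "A n = s (Suc n) n" for n
  have agree: "s n j = A j" if "j < n" for n j
    using that
  proof (induction n)
    case (Suc n)
    obtain b where "s (Suc n) = (s n)(n := b)" using s(3) by blast
    with Suc show ?case by (cases "j = n") (auto simp: A_def)
  qed simp
  have "A \<in> cantor" using s(1) by (simp add: cantor_def A_def)
  moreover have "\<exists>A' \<in> cantor. (\<forall>j<m. A' j = A j) \<and> B m A'" for m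
    using s(2)[of m] agree[of _ m] unfolding ext_def by auto
  ultimately show ?thesis by blast
qed

text \<open>Points of finite support: a number below \<open>2 ^ t\<close> stands for a binary word
  of length \<open>t\<close> and can be used as an oracle.\<close>

definition bits :: "nat \<Rightarrow> baire" where "bits b j = (if j \<in> set_decode b then 1 else 0)"

lemma bits_cantor: "bits b \<in> cantor"
  by (simp add: cantor_def bits_def)

lemma bits_prefix:
  assumes "A \<in> cantor" shows "\<exists>b<2 ^ t. \<forall>j<t. bits b j = A j"
proof -
  define S where "S = {j. j < t \<and> A j = 1}"
  have S: "finite S" "S \<subseteq> {0..<t}" by (auto simp: S_def)
  have "set_encode S \<le> (\<Sum>i = 0..<t. 2 ^ i)"
    unfolding set_encode_def using S(2) by (intro sum_mono2) auto
  also have "\<dots> < 2 ^ t" by (simp add: sum_power2)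
  finally have "set_encode S < 2 ^ t" .
  moreover have "A j = 0 \<or> A j = 1" for j using assms by (auto simp: cantor_def le_Suc_eq)
  then have "\<forall>j<t. bits (set_encode S) j = A j" using S(1) by (auto simp: bits_def S_def)
  ultimately show ?thesis by blast
qed

text \<open>By compactness, some stage \<open>t\<close> bounds the computations \<open>\<phi>\<^sub>c\<^sup>A(n)\<close> for all \<open>A\<close> of Cantor space
  at once, and the least such \<open>t\<close> is computable from \<open>n\<close>.\<close>

lemma computable_bound_on_cantor:
  assumes total: "\<And>A n. A \<in> cantor \<Longrightarrow> run A c n \<noteq> None"
  shows "\<exists>g. g \<le>\<^sub>T (\<lambda>_. 0) \<and> (\<forall>A\<in>cantor. \<forall>n v. run A c n = Some v \<longrightarrow> v \<le> g n)"
proof -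
  define C where "C A n w \<longleftrightarrow> computes_by A (csnd w) (encode c) n (cfst w)" for A n w
  have C: "run A c n = Some v \<longleftrightarrow> (\<exists>s. C A n (cpair v s))" for A n v
    using phi_eq_Some_iff[of A "encode c" n v] by (simp add: C_def)
  have C_local: "C A' n w" if "C A n w" "\<And>j. j < m \<Longrightarrow> A' j = A j" "w < m" for A A' n w m
  proof -
    have "csnd w < m" using csnd_le[of w] that(3) by linarith
    then show ?thesis using that(1,2) computes_by_local unfolding C_def by (metis order.strict_trans)
  qed
  \<comment> \<open>Witnesses below \<open>t\<close> query the oracle only below \<open>t\<close>,
    so finitely many words represent all of Cantor space and the test is decidable.\<close>
  define P where "P n t \<longleftrightarrow> (\<forall>b<2 ^ t. \<exists>w<t. C (bits b) n w)" for n t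
  have ex: "\<exists>t. P n t" for n
  proof (rule ccontr)
    assume none: "\<not> ?thesis"
    have "\<exists>A\<in>cantor. \<forall>m. \<exists>A'\<in>cantor. (\<forall>j<m. A' j = A j) \<and> (\<forall>w<m. \<not> C A' n w)"
    proof (rule cantor_koenig)
      show "\<exists>A\<in>cantor. \<forall>w<m. \<not> C A n w" for m
        using none bits_cantor unfolding P_def by blast
    qed auto
    then obtain A where A: "A \<in> cantor"
      and A': "\<And>m. \<exists>A'\<in>cantor. (\<forall>j<m. A' j = A j) \<and> (\<forall>w<m. \<not> C A' n w)" by blast
    obtain v where "run A c n = Some v" using total[OF A] by blast
    then obtain s where "C A n (cpair v s)" using C by blast
    then show False using A'[of "Suc (cpair v s)"] C_local by (meson lessI)
  qed
  define g where "g n = (LEAST t. P n t)" for n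
  have "computable_pred (\<lambda>p z. P (cfst z) (csnd z))"
    unfolding P_def C_def by (intro computable_intros computable_pred_computes_by_oracle)
      (simp add: bits_def, intro computable_intros)
  then have "computable_pfun (\<lambda>p n. if \<exists>t. P n t then Some (LEAST t. P n t) else None)"
    by (rule computable_pfun_Least)
  then have "computable_fun (\<lambda>p. g)" using ex by (simp add: computable_fun_def g_def)
  then have "g \<le>\<^sub>T (\<lambda>_. 0)" by (rule computable_fun_turing_le)
  moreover have "v \<le> g n" if A: "A \<in> cantor" and v: "run A c n = Some v" for A n v
  proof -
    have "P n (g n)" unfolding g_def using ex by (rule LeastI_ex)
    moreover obtain b where b: "b < 2 ^ g n" "\<forall>j<g n. bits b j = A j"
      using bits_prefix[OF A] by blast
    ultimately obtain w where w: "w < g n" "C (bits b) n w" unfolding P_def by blast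
    have "C A n (cpair (cfst w) (csnd w))" using C_local[OF w(2) _ w(1), of A] b(2) by simp
    then have "run A c n = Some (cfst w)" using C by blast
    \<comment> \<open>A pair is at least as large as its components, so the stage bounds the value
      as well as the certificate.\<close>
    then show ?thesis using v w(1) cfst_le[of w] by simp
  qed
  ultimately show ?thesis by blast
qed

text \<open>The forcing conditions are nonempty \<open>\<Pi>\<^sup>0\<^sub>1\<close> classes, given by a program that must not halt.\<close>

definition pi01_class :: "code \<Rightarrow> baire set" where
  "pi01_class d = {A \<in> cantor. run A d 0 = None}"

text \<open>For a point of \<open>X\<close> on which \<open>c\<close> is total, only the second
  alternative remains, and the function computed is dominated by a computable one.\<close>

definition decided_on :: "code \<Rightarrow> baire set \<Rightarrow> bool" where
  "decided_on c X \<longleftrightarrow> (\<exists>n. \<forall>A\<in>X. run A c n = None) \<or>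
     (\<exists>g. g \<le>\<^sub>T (\<lambda>_. 0) \<and> (\<forall>A\<in>X. \<forall>n v. run A c n = Some v \<longrightarrow> v \<le> g n))"

text \<open>Divergence of \<open>c\<close> at one argument cuts out a smaller class of the same
  kind, since a race of two programs diverges iff both do. If no member allows this, racing
  \<open>c\<close> against \<open>d\<close> gives a program total on all of Cantor space, to which
  the compactness bound applies.\<close>

lemma pi01_class_decide:
  assumes "pi01_class d \<noteq> {}"
  shows "\<exists>d'. pi01_class d' \<noteq> {} \<and> pi01_class d' \<subseteq> pi01_class d \<and>
    decided_on c (pi01_class d')"
proof (cases "\<exists>n. \<exists>A\<in>pi01_class d. run A c n = None")
  case True
  then obtain n A where A: "A \<in> pi01_class d" "run A c n = None" by blast
  have "computable_pfun (\<lambda>p m. run p d 0)" "computable_pfun (\<lambda>p m. run p c n)"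
    by (intro computable_pfun_comp[OF computable_pfun_run] computable_intros)+
  from computable_pfun_parallel[OF this] obtain h where h: "computable_pfun h"
    "\<And>p m. h p m = None \<longleftrightarrow> run p d 0 = None \<and> run p c n = None" by blast
  obtain d' where "\<And>p m. run p d' m = h p m" using h(1) unfolding computable_pfun_def by blast
  then have d': "run p d' m = None \<longleftrightarrow> run p d 0 = None \<and> run p c n = None" for p m using h(2) by simp
  have "A \<in> pi01_class d'" "pi01_class d' \<subseteq> pi01_class d" "\<forall>A\<in>pi01_class d'. run A c n = None"
    using A by (auto simp: pi01_class_def d')
  then show ?thesis unfolding decided_on_def by blast
next
  case False
  have "computable_pfun (\<lambda>p m. run p d 0)" "computable_pfun (\<lambda>p m. run p c m)"
    by (intro computable_pfun_comp[OF computable_pfun_run] computable_intros)+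
  from computable_pfun_parallel[OF this] obtain h where h: "computable_pfun h"
    "\<And>p m. h p m = None \<longleftrightarrow> run p d 0 = None \<and> run p c m = None"
    "\<And>p m v. h p m = Some v \<Longrightarrow> run p d 0 = Some v \<or> run p c m = Some v" by blast
  obtain e where e: "\<And>p m. run p e m = h p m" using h(1) unfolding computable_pfun_def by blast
  have "run A e n \<noteq> None" if "A \<in> cantor" for A n
    using False that by (auto simp: e h(2) pi01_class_def)
  from computable_bound_on_cantor[OF this] obtain g where
    g: "g \<le>\<^sub>T (\<lambda>_. 0)" "\<And>A n v. A \<in> cantor \<Longrightarrow> run A e n = Some v \<Longrightarrow> v \<le> g n" by blast
  have "v \<le> g n" if A: "A \<in> pi01_class d" and v: "run A c n = Some v" for A n v
  proof (rule g(2))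
    show "A \<in> cantor" using A by (simp add: pi01_class_def)
    obtain w where "h A n = Some w" using h(2)[of A n] v by (cases "h A n") auto
    with h(3)[OF this] A v show "run A e n = Some v" by (simp add: pi01_class_def e)
  qed
  then have "decided_on c (pi01_class d)" using g(1) unfolding decided_on_def by blast
  then show ?thesis using assms by blast
qed

text \<open>The class consists of the diagonally noncomputable 0-1 sequences: \<open>A e\<close>
  always differs from \<phi>_e(e), and a counterexample can be found by search.\<close>

lemma pi01_class_noncomputable:
  "\<exists>d. pi01_class d \<noteq> {} \<and> (\<forall>A\<in>pi01_class d. \<not> A \<le>\<^sub>T (\<lambda>_. 0))"
proof -
  define F where "F p e = Option.bind (phi (\<lambda>_. 0) e e) (\<lambda>v. if v = p e then Some v else None)"
    for p :: baire and e
  have "computable_pfun (\<lambda>p z. F p (csnd z))"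
    unfolding F_def
    by (intro computable_pfun_bind computable_pfun_guard computable_pfun_phi_oracle computable_intros)
  then obtain h where h: "computable_pfun h" "\<And>p n. h p n = None \<longleftrightarrow> (\<forall>e. F p e = None)"
    using computable_pfun_search[of "\<lambda>p n. F p"] by blast
  obtain d where "\<And>p m. run p d m = h p m" using h(1) unfolding computable_pfun_def by blast
  then have d: "run p d 0 = None \<longleftrightarrow> (\<forall>e. phi (\<lambda>_. 0) e e \<noteq> Some (p e))" for p
    by (simp add: h(2) F_def split: Option.bind_split)
  have "(\<lambda>e. if phi (\<lambda>_. 0) e e = Some 0 then 1 else 0) \<in> pi01_class d"
    by (simp add: pi01_class_def d cantor_def)
  moreover have "\<not> A \<le>\<^sub>T (\<lambda>_. 0)" if "A \<in> pi01_class d" for A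
    using that unfolding turing_le_def by (auto simp: pi01_class_def d)
  ultimately show ?thesis by blast
qed

lemma hyperimmune_free:
  "\<exists>A. \<not> A \<le>\<^sub>T (\<lambda>_. 0) \<and> (\<forall>r. r \<le>\<^sub>T A \<longrightarrow> (\<exists>g. g \<le>\<^sub>T (\<lambda>_. 0) \<and> (\<forall>n. r n \<le> g n)))"
proof -
  obtain d where d: "pi01_class d \<noteq> {}" "\<And>A. A \<in> pi01_class d \<Longrightarrow> \<not> A \<le>\<^sub>T (\<lambda>_. 0)"
    using pi01_class_noncomputable by blast
  \<comment> \<open>Step \<open>m\<close> settles the program with number \<open>m\<close>, so every
    reduction to a point in all the classes is treated.\<close>
  have "\<exists>D. \<forall>m. (pi01_class (D m) \<noteq> {} \<and> pi01_class (D m) \<subseteq> pi01_class d) \<and>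
      (pi01_class (D (Suc m)) \<subseteq> pi01_class (D m) \<and> decided_on (inv encode m) (pi01_class (D (Suc m))))"
  proof (rule dependent_nat_choice)
    show "\<exists>x. pi01_class x \<noteq> {} \<and> pi01_class x \<subseteq> pi01_class d" using d by blast
    show "\<exists>y. (pi01_class y \<noteq> {} \<and> pi01_class y \<subseteq> pi01_class d) \<and>
        pi01_class y \<subseteq> pi01_class x \<and> decided_on (inv encode m) (pi01_class y)"
      if "pi01_class x \<noteq> {} \<and> pi01_class x \<subseteq> pi01_class d" for x m
      using pi01_class_decide[of x "inv encode m"] that by blast
  qed
  then obtain D where *: "\<forall>m. (pi01_class (D m) \<noteq> {} \<and> pi01_class (D m) \<subseteq> pi01_class d) \<and>
      (pi01_class (D (Suc m)) \<subseteq> pi01_class (D m) \<and> decided_on (inv encode m) (pi01_class (D (Suc m))))" ..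
  then have D: "\<And>m. pi01_class (D m) \<noteq> {}" "\<And>m. pi01_class (D m) \<subseteq> pi01_class d"
    "\<And>m. pi01_class (D (Suc m)) \<subseteq> pi01_class (D m)" "\<And>m. decided_on (inv encode m) (pi01_class (D (Suc m)))"
    by simp_all
  have mono: "pi01_class (D m) \<subseteq> pi01_class (D j)" if "j \<le> m" for j m
    using D(3) that by (rule lift_Suc_antimono_le)
  define C where "C A j w \<longleftrightarrow> computes_by A (csnd w) (encode (D j)) 0 (cfst w)" for A j w
  have C: "run A (D j) 0 = Some v \<longleftrightarrow> (\<exists>s. C A j (cpair v s))" for A j v
    using phi_eq_Some_iff[of A "encode (D j)" 0 v] by (simp add: C_def)
  \<comment> \<open>The intersection of the nested classes is nonempty by compactness, applied to
    the approximations that exclude witnesses below \<open>m\<close> for the first \<open>m\<close>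
    classes.\<close>
  have "\<exists>A\<in>cantor. \<forall>m. \<exists>A'\<in>cantor. (\<forall>i<m. A' i = A i) \<and> (\<forall>j<m. \<forall>w<m. \<not> C A' j w)"
  proof (rule cantor_koenig)
    fix m
    obtain A where A: "A \<in> pi01_class (D m)" using D(1) by blast
    have "run A (D j) 0 = None" if "j < m" for j
      using mono[of j m] A that by (auto simp: pi01_class_def)
    then have "\<not> C A j w" if "j < m" for j w
      using that C[of A j "cfst w"] by (metis cpair_cfst_csnd option.distinct(1))
    then show "\<exists>A\<in>cantor. \<forall>j<m. \<forall>w<m. \<not> C A j w" using A by (auto simp: pi01_class_def)
  qed auto
  then obtain A where A: "A \<in> cantor"
    and A': "\<And>m. \<exists>A'\<in>cantor. (\<forall>i<m. A' i = A i) \<and> (\<forall>j<m. \<forall>w<m. \<not> C A' j w)" by blast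
  have mem: "A \<in> pi01_class (D j)" for j
  proof (rule ccontr)
    assume "A \<notin> pi01_class (D j)"
    then obtain v where "run A (D j) 0 = Some v" using A by (auto simp: pi01_class_def)
    then obtain s where s: "computes_by A s (encode (D j)) 0 v" using C by (auto simp: C_def)
    \<comment> \<open>Large enough to include class \<open>j\<close> and its witness, and also to
      fix all oracle queries of the certificate.\<close>
    define m where "m = Suc (max j (cpair v s))"
    obtain A' where A': "\<forall>i<m. A' i = A i" "\<forall>j<m. \<forall>w<m. \<not> C A' j w" using A' by blast
    have "s < m" using le_cpair(2)[of s v] by (simp add: m_def)
    then have "computes_by A' s (encode (D j)) 0 v"
      using computes_by_local[OF s, of A'] A'(1) by simp
    then have "C A' j (cpair v s)" by (simp add: C_def)
    moreover have "j < m" "cpair v s < m" by (simp_all add: m_def)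
    ultimately show False using A'(2) by blast
  qed
  have "\<exists>g. g \<le>\<^sub>T (\<lambda>_. 0) \<and> (\<forall>n. r n \<le> g n)" if r: "r \<le>\<^sub>T A" for r
  proof -
    obtain i where "\<And>n. phi A i n = Some (r n)" using r unfolding turing_le_def by blast
    then have run: "\<And>n. run A (inv encode i) n = Some (r n)" by (simp add: phi_def)
    then show ?thesis using D(4)[of i] mem[of "Suc i"] unfolding decided_on_def by force
  qed
  moreover have "\<not> A \<le>\<^sub>T (\<lambda>_. 0)" using d(2) D(2) mem by blast
  ultimately show ?thesis by blast
qed

text \<open>At the zero instance, a noncomputable \<open>A\<close> of hyperimmune-free degree
  answers the question put to \<open>NON\<close>. The degree returned is below \<open>A\<close>, so
  the hyperimmune function it computes would be dominated by a computable one.\<close>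

lemma not_HYP_degree_le_NON: "\<not> HYP\<^sup>D \<le>\<^sub>W NON"
proof
  assume "HYP\<^sup>D \<le>\<^sub>W NON"
  then have "\<exists>k c. computable_fun k \<and> (\<forall>p q. q \<in> sol NON (k p) \<longrightarrow>
    (\<exists>r. (\<forall>n. run (join p q) c n = Some (r n)) \<and> (\<exists>z. out_rep (HYP\<^sup>D) r = Some z \<and> z \<in> sol (HYP\<^sup>D) p)))"
    by (rule weihrauch_le_baireD)
      (simp_all add: is_problem_basic pdom_HYP pdom_degree_version,
       simp_all add: degree_version_def HYP_def NON_def)
  then obtain k c where k: "computable_fun k" and
    kc: "\<And>p q. q \<in> sol NON (k p) \<Longrightarrow> \<exists>r. (\<forall>n. run (join p q) c n = Some (r n)) \<and> deg r \<in> sol (HYP\<^sup>D) p"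
    by (auto simp: degree_version_def degree_rep_def)
  let ?zero = "\<lambda>_::nat. 0::nat"
  obtain A where A: "\<not> A \<le>\<^sub>T ?zero" "\<And>r. r \<le>\<^sub>T A \<Longrightarrow> \<exists>g. g \<le>\<^sub>T ?zero \<and> (\<forall>n. r n \<le> g n)"
    using hyperimmune_free unfolding o_def by blast
  have "k ?zero \<le>\<^sub>T ?zero" by (rule computable_fun_turing_le[OF k])
  then have "A \<in> sol NON (k ?zero)" using A(1) turing_trans by (auto simp: NON_def)
  then obtain r where r: "\<And>n. run (join ?zero A) c n = Some (r n)" "deg r \<in> sol (HYP\<^sup>D) ?zero"
    using kc by blast
  obtain s y where s: "deg r = deg s" "y \<in> sol HYP ?zero" "y \<le>\<^sub>T s"
    using r(2) by (auto simp: degree_version_def HYP_def baire_rep_def)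
  have "s \<in> deg r" using s(1) turing_refl by (simp add: deg_def)
  then have "s \<le>\<^sub>T r" by (simp add: deg_def)
  moreover have "r \<le>\<^sub>T join ?zero A" using r(1) unfolding turing_le_iff by blast
  moreover have "join ?zero A \<le>\<^sub>T A"
    unfolding o_def by (intro computable_fun_turing_le[of "\<lambda>q. join (\<lambda>_. 0) q"] computable_intros)
  ultimately have "y \<le>\<^sub>T A" using s(3) turing_trans by blast
  then obtain g where "g \<le>\<^sub>T ?zero" "\<And>n. y n \<le> g n" using A(2) by blast
  then show False using s(2) by (auto simp: HYP_def not_less[symmetric])
qed

theorem proposition6p3:
  shows "\<Sigma>\<^sub>P NMAJ \<equiv>\<^sub>W \<Sigma>\<^sub>P NGEQ \<and> \<Sigma>\<^sub>P NGEQ \<equiv>\<^sub>W DIS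
    \<and> \<Pi>\<^sub>P NMAJ \<equiv>\<^sub>s\<^sub>W HYP
    \<and> DIS <\<^sub>W NMAJ \<and> NMAJ <\<^sub>W HYP
    \<and> NON <\<^sub>W HYP\<^sup>D
    \<and> \<not> NMAJ \<equiv>\<^sub>W \<Sigma>\<^sub>P NMAJ"
  unfolding weihrauch_equiv_def strong_weihrauch_equiv_def weihrauch_less_def
  using weihrauch_trans[OF stashing_NMAJ_le_DIS DIS_le_stashing_NGEQ]
    weihrauch_trans[OF stashing_NGEQ_le_DIS DIS_le_stashing_NMAJ]
    stashing_NGEQ_le_DIS DIS_le_stashing_NGEQ parallel_NMAJ_le_HYP HYP_le_parallel_NMAJ
    DIS_le_NMAJ not_NMAJ_le_DIS NMAJ_le_HYP not_HYP_le_NMAJ NON_le_HYP_degree not_HYP_degree_le_NON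
    \<comment> \<open>Stashability would reduce \<open>NMAJ\<close> to \<open>DIS\<close> through
      its own stashing.\<close>
    weihrauch_trans[OF _ stashing_NMAJ_le_DIS, of NMAJ]
  by blast

end
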